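(* Let $f,g\in H$. Then either the subgroup $\langle f,g\rangle$ generated by $f$ and $g$ is metabelian, or it contains a free abelian subgroup of rank two.
   Context: Let $\mathbb{P}^1=\mathbb{P}^1(\mathbb{R})$ with its usual topology (a circle) and the natural action of $\mathrm{PSL}_2(\mathbb{R})$. Let $G$ be the group of homeomorphisms of $\mathbb{P}^1$ which are piecewise in $\mathrm{PSL}_2(\mathbb{R})$ with finitely many pieces, each an interval of $\mathbb{P}^1$. Let $\infty\in\mathbb{P}^1$ be the point corresponding to the first basis vector of $\mathbb{R}^2$ and $H<G$ the stabilizer of $\infty$. *)

theory Defs
  imports "HOL-Analysis.Analysis" "HOL-Algebra.Algebra"
begin

definition line :: "real \<times> real \<Rightarrow> (real \<times> real) set" where
  "line v = range (\<lambda>c. c *\<^sub>R v)"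

typedef P1 = "{L. \<exists>v::real \<times> real. v \<noteq> 0 \<and> L = line v}"
proof show "line (1,0) \<in> {L. \<exists>v::real \<times> real. v \<noteq> 0 \<and> L = line v}" using zero_neq_one by (metis (mono_tags, lifting) fst_zero fst_conv mem_Collect_eq) qed

definition P1_of :: "real \<times> real \<Rightarrow> P1" where
  "P1_of v = Abs_P1 (line v)"

instantiation P1 :: topological_space
begin

definition open_P1 :: "P1 set \<Rightarrow> bool" where
  "open_P1 U \<longleftrightarrow> open {v :: real \<times> real. v \<noteq> 0 \<and> P1_of v \<in> U}"

instance
proof
  have "{v :: real \<times> real. v \<noteq> 0 \<and> P1_of v \<in> UNIV} = - {0}" by auto
  then show "open (UNIV :: P1 set)" unfolding open_P1_def by (simp add: open_Compl)
next
  fix S T :: "P1 set"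
  assume "open S" "open T"
  moreover have "{v :: real \<times> real. v \<noteq> 0 \<and> P1_of v \<in> S \<inter> T}
      = {v. v \<noteq> 0 \<and> P1_of v \<in> S} \<inter> {v. v \<noteq> 0 \<and> P1_of v \<in> T}" by auto
  ultimately show "open (S \<inter> T)" unfolding open_P1_def by (simp add: open_Int)
next
  fix K :: "P1 set set"
  assume "\<forall>S\<in>K. open S"
  moreover have "{v :: real \<times> real. v \<noteq> 0 \<and> P1_of v \<in> \<Union>K}
      = (\<Union>S\<in>K. {v. v \<noteq> 0 \<and> P1_of v \<in> S})" by auto
  ultimately show "open (\<Union>K)" unfolding open_P1_def by (auto intro: open_UN)
qed

end

definition proj_map :: "real \<Rightarrow> real \<Rightarrow> real \<Rightarrow> real \<Rightarrow> P1 \<Rightarrow> P1" where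
  "proj_map a b c d p =
     Abs_P1 ((\<lambda>(x, y). (a * x + b * y, c * x + d * y)) ` Rep_P1 p)"

definition PSL2 :: "(P1 \<Rightarrow> P1) set" where
  "PSL2 = {proj_map a b c d | a b c d. a * d - b * c = 1}"

definition infty :: P1 where
  "infty = P1_of (1, 0)"

text \<open>Intervals of P^1 are its connected subsets (arcs, points, empty set, whole circle).\<close>

definition piecewise_PSL2 :: "(P1 \<Rightarrow> P1) \<Rightarrow> bool" where
  "piecewise_PSL2 f \<longleftrightarrow>
     (\<exists>I. finite I \<and> \<Union>I = UNIV \<and>
          (\<forall>S\<in>I. connected S \<and> (\<exists>h\<in>PSL2. \<forall>x\<in>S. f x = h x)))"

definition Gset :: "(P1 \<Rightarrow> P1) set" where
  "Gset = {f. (\<exists>g. homeomorphism UNIV UNIV f g) \<and> piecewise_PSL2 f}"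

definition Hset :: "(P1 \<Rightarrow> P1) set" where
  "Hset = {f \<in> Gset. f infty = infty}"

definition Ggrp :: "(P1 \<Rightarrow> P1) monoid" where
  "Ggrp = \<lparr>carrier = Gset, monoid.mult = (\<circ>), one = id\<rparr>"

definition metabelian_in :: "('a, 'b) monoid_scheme \<Rightarrow> 'a set \<Rightarrow> bool" where
  "metabelian_in Gr K \<longleftrightarrow> comm_group (Gr\<lparr>carrier := derived Gr K\<rparr>)"

definition contains_Z2_in :: "('a, 'b) monoid_scheme \<Rightarrow> 'a set \<Rightarrow> bool" where
  "contains_Z2_in Gr K \<longleftrightarrow>
     (\<exists>A. A \<subseteq> K \<and> subgroup A Gr \<and>
          Gr\<lparr>carrier := A\<rparr> \<cong> DirProd integer_group integer_group)"

end

theory Submission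
  imports Defs "HOL-Real_Asymp.Real_Asymp"
begin

text \<open>In the affine chart \<open>x \<mapsto> [x : 1]\<close>, the group \<open>H\<close> acts on the line by increasing homeomorphisms
  that are Moebius maps off a finite set. Let \<open>C\<close> be the common fixed point set of \<open>f\<close> and \<open>g\<close>; its
  frontier \<open>E\<close> is finite, so the complement of \<open>C\<close> has finitely many components. At each end of
  these components the one-sided germs of elements of \<open>K = \<langle>f, g\<rangle>\<close> are affine in a suitable coordinate.
  Hence germs of elements of the derived subgroup are translations, and a nontrivial commutator of
  two such elements is trivial near all the ends. Among nontrivial elements of \<open>K\<close> with the latter
  property, choose \<open>u\<close> whose support meets the fewest components. In one of these components some
  \<open>h \<in> K\<close> moves the support of \<open>u\<close> off itself. By minimality \<open>u\<close> and its conjugate by \<open>h\<close> commute,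
  and since their supports in that component are disjoint they generate a free abelian group of
  rank two.\<close>

subsection \<open>The affine chart of the projective line\<close>

definition chart :: "real \<Rightarrow> P1" where
  "chart x = P1_of (x, 1)"

lemma line_eq_iff:
  assumes "v \<noteq> 0" "w \<noteq> 0"
  shows "line v = line w \<longleftrightarrow> fst v * snd w = snd v * fst w"
proof
  assume "line v = line w"
  moreover have "v \<in> line v" unfolding line_def by (metis rangeI scaleR_one)
  ultimately obtain c where "v = c *\<^sub>R w" unfolding line_def by auto
  then show "fst v * snd w = snd v * fst w" by simp
next
  assume cross: "fst v * snd w = snd v * fst w"
  obtain k where k: "v = k *\<^sub>R w"
  proof (cases "fst w = 0")
    case True
    then have "snd w \<noteq> 0" using assms(2) by (simp add: prod_eq_iff)
    with cross True have "v = (snd v / snd w) *\<^sub>R w" by (simp add: prod_eq_iff)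
    then show ?thesis using that by blast
  next
    case False
    with cross have "v = (fst v / fst w) *\<^sub>R w" by (simp add: prod_eq_iff field_simps)
    then show ?thesis using that by blast
  qed
  with assms have k0: "k \<noteq> 0" by auto
  show "line v = line w"
  proof
    show "line v \<subseteq> line w" unfolding line_def k by auto
    show "line w \<subseteq> line v"
    proof
      fix u assume "u \<in> line w"
      then obtain c where "u = c *\<^sub>R w" unfolding line_def by auto
      then have "u = (c / k) *\<^sub>R v" using k k0 by simp
      then show "u \<in> line v" unfolding line_def by blast
    qed
  qed
qed

lemma Rep_P1_of: "v \<noteq> 0 \<Longrightarrow> Rep_P1 (P1_of v) = line v"
  unfolding P1_of_def by (rule Abs_P1_inverse) blast

lemma P1_of_eq_iff:
  assumes "v \<noteq> 0" "w \<noteq> 0"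
  shows "P1_of v = P1_of w \<longleftrightarrow> fst v * snd w = snd v * fst w"
  using line_eq_iff[OF assms] Rep_P1_of[OF assms(1)] Rep_P1_of[OF assms(2)]
  by (metis P1_of_def)

lemma P1_of_surj: "\<exists>v. v \<noteq> 0 \<and> p = P1_of v"
proof -
  obtain v where "v \<noteq> 0" "Rep_P1 p = line v" using Rep_P1[of p] by blast
  then have "v \<noteq> 0 \<and> p = P1_of v" unfolding P1_of_def using Rep_P1_inverse[of p] by metis
  then show ?thesis ..
qed

lemma chart_eq_iff [simp]: "chart x = chart y \<longleftrightarrow> x = y"
  unfolding chart_def by (subst P1_of_eq_iff) (auto simp: zero_prod_def)

lemma chart_neq_infty [simp]: "chart x \<noteq> infty" "infty \<noteq> chart x"
  unfolding chart_def infty_def by (subst P1_of_eq_iff; auto simp: zero_prod_def)+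

lemma P1_of_pair:
  assumes "(x, y) \<noteq> 0"
  shows "P1_of (x, y) = (if y = 0 then infty else chart (x / y))"
  using assms unfolding chart_def infty_def
  by (auto simp: P1_of_eq_iff zero_prod_def)

lemma P1_cases: obtains "p = infty" | x where "p = chart x"
  using P1_of_surj[of p] P1_of_pair by (metis surj_pair)

text \<open>The value at \<open>infty\<close> is unspecified. For \<open>f\<close> in
  \<open>Hset\<close> this does no harm, because \<open>f (chart x)\<close> is never
  \<open>infty\<close>.\<close>

definition coord :: "P1 \<Rightarrow> real" where
  "coord = inv_into UNIV chart"

lemma coord_chart [simp]: "coord (chart x) = x"
  unfolding coord_def by (rule inv_f_f) (simp add: inj_on_def)

lemma chart_coord: "p \<noteq> infty \<Longrightarrow> chart (coord p) = p"
  by (cases p rule: P1_cases) auto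

lemma proj_map_P1_of:
  assumes "v \<noteq> 0" "a * d - b * c \<noteq> 0"
  shows "proj_map a b c d (P1_of v) = P1_of (a * fst v + b * snd v, c * fst v + d * snd v)"
proof -
  have "(\<lambda>(x, y). (a * x + b * y, c * x + d * y)) ` line v =
    line (a * fst v + b * snd v, c * fst v + d * snd v)"
    unfolding line_def image_image
    by (intro image_cong) (auto simp: case_prod_beta algebra_simps)
  then show ?thesis
    unfolding proj_map_def Rep_P1_of[OF assms(1)] by (simp add: P1_of_def)
qed

lemma proj_map_chart:
  assumes "a * d - b * c = 1"
  shows "proj_map a b c d (chart x) =
    (if c * x + d = 0 then infty else chart ((a * x + b) / (c * x + d)))"
proof -
  have "(a * x + b, c * x + d) \<noteq> 0"
  proof
    assume *: "(a * x + b, c * x + d) = 0"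
    then have "b = - a * x" "d = - c * x" by (auto simp: zero_prod_def)
    then have "a * d - b * c = 0" by simp
    with assms show False by simp
  qed
  then show ?thesis
    using proj_map_P1_of[of "(x, 1)" a d b c] assms unfolding chart_def[of x]
    by (simp add: zero_prod_def P1_of_pair)
qed

lemma proj_map_id: "proj_map 1 0 0 1 = id"
proof
  fix p
  obtain v where "v \<noteq> 0" "p = P1_of v" using P1_of_surj by blast
  then show "proj_map 1 0 0 1 p = id p" by (simp add: proj_map_P1_of)
qed

section \<open>Connected subsets of the circle seen in the chart\<close>

definition pos_region :: "(real \<times> real \<Rightarrow> real) \<Rightarrow> P1 set" where
  "pos_region q = {p. \<exists>v. v \<noteq> 0 \<and> p = P1_of v \<and> q v > 0}"

text \<open>Rescaling a vector multiplies \<open>q\<close> by a square. Hence the sign of a function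
  homogeneous of degree two descends to the projective line, while that of a linear form does
  not.\<close>

lemma P1_of_in_pos_region:
  assumes hom: "\<And>k v. q (k *\<^sub>R v) = k\<^sup>2 * q v" and "v \<noteq> 0"
  shows "P1_of v \<in> pos_region q \<longleftrightarrow> q v > 0"
proof
  assume "P1_of v \<in> pos_region q"
  then obtain w where w: "w \<noteq> 0" "P1_of v = P1_of w" "q w > 0"
    unfolding pos_region_def by auto
  then have "line v = line w" using assms(2) Rep_P1_of by metis
  moreover have "w \<in> line w" unfolding line_def by (metis rangeI scaleR_one)
  ultimately obtain k where "w = k *\<^sub>R v" unfolding line_def by auto
  with w(3) show "q v > 0" by (metis hom mult_le_0_iff not_le zero_le_power2)
next
  assume "q v > 0"
  with assms(2) show "P1_of v \<in> pos_region q" unfolding pos_region_def by blast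
qed

lemma open_pos_region:
  assumes hom: "\<And>k v. q (k *\<^sub>R v) = k\<^sup>2 * q v" and "continuous_on UNIV q"
  shows "open (pos_region q)"
proof -
  have "{v. v \<noteq> 0 \<and> P1_of v \<in> pos_region q} = {v. v \<noteq> 0} \<inter> {v. 0 < q v}"
    using P1_of_in_pos_region[OF hom] by auto
  moreover have "open {v. 0 < q v}"
    using assms(2) by (intro open_Collect_less) auto
  moreover have "open {v :: real \<times> real. v \<noteq> 0}" by (intro open_Collect_neq continuous_intros)
  ultimately show ?thesis unfolding open_P1_def by (simp add: open_Int)
qed

text \<open>Applied to a product of two linear forms, this separates the two arcs between two points.\<close>

lemma connected_sign_const:
  assumes hom: "\<And>k v. q (k *\<^sub>R v) = k\<^sup>2 * q v" and cont: "continuous_on UNIV q"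
    and "connected S" and nz: "\<And>v. v \<noteq> 0 \<Longrightarrow> P1_of v \<in> S \<Longrightarrow> q v \<noteq> 0"
    and vw: "v \<noteq> 0" "P1_of v \<in> S" "w \<noteq> 0" "P1_of w \<in> S" "q v > 0"
  shows "q w > 0"
proof (rule ccontr)
  assume "\<not> q w > 0"
  then have w: "- q w > 0" using nz[OF vw(3,4)] by linarith
  let ?r = "\<lambda>v. - q v"
  have hom': "?r (k *\<^sub>R v) = k\<^sup>2 * ?r v" for k v by (simp add: hom)
  have cont': "continuous_on UNIV ?r" using cont by (rule continuous_on_minus)
  note in_q = P1_of_in_pos_region[OF hom] and in_r = P1_of_in_pos_region[of ?r, OF hom']
  have "pos_region q \<inter> pos_region ?r \<inter> S = {}"
  proof -
    have False if "p \<in> pos_region q" "p \<in> pos_region ?r" for p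
      using P1_of_surj[of p] in_q in_r that by force
    then show ?thesis by auto
  qed
  moreover have "S \<subseteq> pos_region q \<union> pos_region ?r"
  proof
    fix p assume "p \<in> S"
    then show "p \<in> pos_region q \<union> pos_region ?r"
      using P1_of_surj[of p] in_q in_r nz by force
  qed
  ultimately have "pos_region q \<inter> S = {} \<or> pos_region ?r \<inter> S = {}"
    using connectedD[OF \<open>connected S\<close> open_pos_region[OF hom cont] open_pos_region[of ?r, OF hom' cont']]
    by blast
  then show False using in_q[of v] in_r[of w] vw w by auto
qed

lemma continuous_chart: "continuous_on UNIV chart"
  unfolding continuous_on_open_vimage[OF open_UNIV]
proof (intro allI impI)
  fix U :: "P1 set" assume "open U"
  then have "open {v :: real \<times> real. v \<noteq> 0 \<and> P1_of v \<in> U}" unfolding open_P1_def .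
  moreover have "continuous_on UNIV (\<lambda>x::real. (x, 1::real))" by (intro continuous_intros)
  ultimately have "open ((\<lambda>x. (x, 1)) -` {v :: real \<times> real. v \<noteq> 0 \<and> P1_of v \<in> U})"
    by (rule open_vimage)
  moreover have "(\<lambda>x. (x, 1)) -` {v :: real \<times> real. v \<noteq> 0 \<and> P1_of v \<in> U} = chart -` U"
    by (auto simp: chart_def zero_prod_def)
  ultimately show "open (chart -` U \<inter> UNIV)" by simp
qed

lemma open_chart_interval: "open (chart ` {a<..<b})"
proof -
  \<comment> \<open>For a < b this form is positive at (x, 1) exactly when x lies strictly between a
    and b, and it equals -1 at (1, 0); so it cuts out the arc that avoids
    \<open>infty\<close>.\<close>
  let ?q = "\<lambda>v :: real \<times> real. (fst v - a * snd v) * (b * snd v - fst v)"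
  have hom: "?q (k *\<^sub>R v) = k\<^sup>2 * ?q v" for k v by (simp add: power2_eq_square algebra_simps)
  have cont: "continuous_on UNIV ?q" by (intro continuous_intros)
  show ?thesis
  proof (cases "a < b")
    case True
    have "p \<in> pos_region ?q \<longleftrightarrow> p \<in> chart ` {a<..<b}" for p
    proof (cases p rule: P1_cases)
      case 1
      have "infty \<notin> pos_region ?q"
        using P1_of_in_pos_region[of ?q "(1,0)", OF hom] by (simp add: infty_def zero_prod_def)
      then show ?thesis using 1 by auto
    next
      case (2 x)
      have "chart x \<in> pos_region ?q \<longleftrightarrow> (x - a) * (b - x) > 0"
        using P1_of_in_pos_region[of ?q "(x,1)", OF hom] by (simp add: chart_def zero_prod_def)
      also have "\<dots> \<longleftrightarrow> a < x \<and> x < b" using True by (auto simp: zero_less_mult_iff)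
      finally show ?thesis using 2 by auto
    qed
    then have "pos_region ?q = chart ` {a<..<b}" by auto
    then show ?thesis using open_pos_region[of ?q, OF hom cont] by simp
  qed simp
qed

lemma convex_real_iff: "convex (S :: real set) \<longleftrightarrow> (\<forall>x\<in>S. \<forall>z\<in>S. \<forall>y. x \<le> y \<longrightarrow> y \<le> z \<longrightarrow> y \<in> S)"
  using is_interval_convex_1 is_interval_1 by (metis (no_types, lifting))

text \<open>The two cases are arcs that avoid \<open>infty\<close> and arcs that contain it. If
  convexity failed, two points outside \<open>S\<close> would separate two points of
  \<open>S\<close> on the circle, and the product of the linear forms vanishing at the former would
  change sign on \<open>S\<close> without a zero.\<close>

lemma connected_P1_chart:
  assumes "connected S"
  shows "convex (chart -` S) \<or> convex (- (chart -` S))"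
proof (cases "infty \<in> S")
  case False
  have "y \<in> chart -` S" if xz: "chart x \<in> S" "chart z \<in> S" and "x \<le> y" "y \<le> z" for x y z
  proof (rule ccontr)
    assume y: "y \<notin> chart -` S"
    then have "x < y" "y < z" using that by (metis order_less_le vimageI2)+
    \<comment> \<open>The zeros are [y : 1] and \<open>infty\<close>, both outside \<open>S\<close>;
      the form is positive at x and negative at z.\<close>
    let ?q = "\<lambda>v :: real \<times> real. (fst v - y * snd v) * (- snd v)"
    have hom: "?q (k *\<^sub>R v) = k\<^sup>2 * ?q v" for k v by (simp add: power2_eq_square algebra_simps)
    have cont: "continuous_on UNIV ?q" by (intro continuous_intros)
    have nz: "?q v \<noteq> 0" if "v \<noteq> 0" "P1_of v \<in> S" for v
      using that y False P1_of_pair[of "fst v" "snd v"] by (auto split: if_splits)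
    show False
      using connected_sign_const[of ?q "S" "(x,1)" "(z,1)", OF hom cont assms nz] xz
        \<open>x < y\<close> \<open>y < z\<close> by (simp add: zero_prod_def chart_def)
  qed
  then have "convex (chart -` S)" unfolding convex_real_iff vimage_eq by blast
  then show ?thesis ..
next
  case True
  have "y \<notin> chart -` S" if xz: "chart x \<notin> S" "chart z \<notin> S" and "x \<le> y" "y \<le> z" for x y z
  proof
    assume y: "y \<in> chart -` S"
    then have "x < y" "y < z" using that by (metis order_less_le vimageE)+
    \<comment> \<open>The zeros x and z lie outside \<open>S\<close>; the form equals 1 at (1, 0)
      and is negative at y, which lies strictly between them.\<close>
    let ?q = "\<lambda>v :: real \<times> real. (fst v - x * snd v) * (fst v - z * snd v)"
    have hom: "?q (k *\<^sub>R v) = k\<^sup>2 * ?q v" for k v by (simp add: power2_eq_square algebra_simps)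
    have cont: "continuous_on UNIV ?q" by (intro continuous_intros)
    have nz: "?q v \<noteq> 0" if "v \<noteq> 0" "P1_of v \<in> S" for v
      using that xz P1_of_pair[of "fst v" "snd v"] by (auto simp: zero_prod_def prod_eq_iff split: if_splits)
    have "?q (y, 1) > 0"
      using connected_sign_const[of ?q "S" "(1,0)" "(y,1)", OF hom cont assms nz] y True
      by (simp add: zero_prod_def chart_def infty_def)
    then show False using \<open>x < y\<close> \<open>y < z\<close> by (simp add: zero_less_mult_iff)
  qed
  then have "convex (- (chart -` S))" unfolding convex_real_iff Compl_iff vimage_eq by blast
  then show ?thesis ..
qed

text \<open>A convex set of reals is one of ten kinds of interval, and only its end points can lie
  on the frontier.\<close>

lemma finite_frontier_convex_real:
  fixes S :: "real set"
  assumes "convex S"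
  shows "finite (frontier S)"
proof -
  have "\<And>a b x. a \<in> S \<Longrightarrow> b \<in> S \<Longrightarrow> a \<le> x \<Longrightarrow> x \<le> b \<Longrightarrow> x \<in> S"
    using assms convex_real_iff by blast
  from interval_cases[of S, OF this] have
    "\<exists>a b. S \<in> {{}, UNIV, {..<b}, {..b}, {a<..}, {a..}, {a<..<b}, {a<..b}, {a..<b}, {a..b}}"
    by (simp only: insert_iff empty_iff simp_thms)
  then obtain a b where
    "S \<in> {{}, UNIV, {..<b}, {..b}, {a<..}, {a..}, {a<..<b}, {a<..b}, {a..<b}, {a..b}}" by blast
  moreover have "frontier T \<subseteq> {a, b}"
    if "T \<in> {{}, UNIV, {..<b}, {..b}, {a<..}, {a..}, {a<..<b}, {a<..b}, {a..<b}, {a..b}}" for T :: "real set"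
    using that by (cases "a < b") (auto simp: frontier_def interior_open not_less)
  ultimately show ?thesis by (meson finite.emptyI finite.insertI finite_subset)
qed

subsection \<open>Piecewise Moebius homeomorphisms of the line\<close>

text \<open>Excluding the pole from \<open>J\<close> keeps the convention 1 / 0 = 0 out of the
  formula, and it is what makes the map increasing on a convex \<open>J\<close>.\<close>

definition mobius_on :: "real set \<Rightarrow> (real \<Rightarrow> real) \<Rightarrow> bool" where
  "mobius_on J F \<longleftrightarrow> (\<exists>a b c d. a * d - b * c = 1 \<and>
     (\<forall>x\<in>J. c * x + d \<noteq> 0 \<and> F x = (a * x + b) / (c * x + d)))"

text \<open>Quantifying over all convex sets that avoid a finite set of break points, instead of
  listing pieces, lets break points be added freely. The values at the break points themselves are
  left open.\<close>

definition pw_mobius :: "(real \<Rightarrow> real) \<Rightarrow> bool" where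
  "pw_mobius F \<longleftrightarrow> (\<exists>B. finite B \<and> (\<forall>J. convex J \<longrightarrow> J \<inter> B = {} \<longrightarrow> mobius_on J F))"

text \<open>The counterpart of \<open>Hset\<close> on the line. Continuity is implied, because an
  increasing surjection of the line has no jumps.\<close>

definition PM :: "(real \<Rightarrow> real) set" where
  "PM = {F. strict_mono F \<and> surj F \<and> pw_mobius F}"

text \<open>For finite \<open>E\<close>, a component of the complement is coded by the set of points
  of \<open>E\<close> below it. This bounds the number of components by the number of subsets of
  \<open>E\<close>, without enumerating \<open>E\<close> in order.\<close>

definition cut :: "real set \<Rightarrow> real \<Rightarrow> real set" where
  "cut E x = {e\<in>E. e < x}"

definition gap :: "real set \<Rightarrow> real set \<Rightarrow> real set" where
  "gap E Z = {x. x \<notin> E \<and> cut E x = Z}"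

lemma convex_gap: "convex (gap E Z)"
  unfolding convex_real_iff
proof (intro ballI allI impI)
  fix x y z assume xz: "x \<in> gap E Z" "z \<in> gap E Z" "x \<le> y" "y \<le> z"
  have "y \<notin> E"
  proof
    assume y: "y \<in> E"
    then have "y < z" using xz unfolding gap_def by (metis (no_types, lifting) mem_Collect_eq order_less_le)
    then have "y \<in> cut E z" using y unfolding cut_def by simp
    then have "y \<in> cut E x" using xz unfolding gap_def by simp
    then show False using xz unfolding cut_def by simp
  qed
  moreover have "cut E x \<subseteq> cut E y" "cut E y \<subseteq> cut E z"
    using xz unfolding cut_def by auto
  ultimately show "y \<in> gap E Z" using xz unfolding gap_def by auto
qed

lemma gap_disjoint: "gap E Z \<inter> E = {}"
  unfolding gap_def by auto

lemma cut_in_Pow: "cut E x \<in> Pow E"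
  unfolding cut_def by auto

lemma mobius_on_empty: "mobius_on {} F"
  unfolding mobius_on_def by (rule exI[of _ 1], rule exI[of _ 0], rule exI[of _ 0], rule exI[of _ 1]) simp

text \<open>By the determinant condition, F y - F x = (y - x) / ((c x + d) (c y + d)). The two
  denominators have the same sign, since otherwise the pole - d / c would lie between x and y and
  hence in \<open>J\<close>.\<close>

lemma mobius_on_increasing:
  assumes "mobius_on J F" "convex J" "x \<in> J" "y \<in> J" "x < y"
  shows "F x < F y"
proof -
  obtain a b c d where det: "a * d - b * c = 1"
    and F: "\<And>x. x \<in> J \<Longrightarrow> c * x + d \<noteq> 0" "\<And>x. x \<in> J \<Longrightarrow> F x = (a * x + b) / (c * x + d)"
    using assms(1) unfolding mobius_on_def by blast
  have "(c * x + d) * (c * y + d) > 0"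
  proof (rule ccontr)
    assume "\<not> ?thesis"
    moreover have nz: "(c * x + d) * (c * y + d) \<noteq> 0" using F(1) assms by simp
    ultimately have neg: "(c * x + d) * (c * y + d) < 0" by linarith
    then have "c \<noteq> 0" by (auto simp: zero_le_square not_less[symmetric])
    have "x \<le> - d / c \<and> - d / c \<le> y"
    proof (cases "c > 0")
      case True
      then have "c * x < c * y" using \<open>x < y\<close> by simp
      then have "c * x + d < 0" "c * y + d > 0" using neg by (auto simp: mult_less_0_iff)
      then show ?thesis using True by (simp add: field_simps)
    next
      case False
      then have "c < 0" using \<open>c \<noteq> 0\<close> by simp
      then have "c * y < c * x" using \<open>x < y\<close> by simp
      then have "c * y + d < 0" "c * x + d > 0" using neg by (auto simp: mult_less_0_iff)
      then show ?thesis using \<open>c < 0\<close> by (simp add: field_simps)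
    qed
    then have "- d / c \<in> J" using assms convex_real_iff by blast
    then have "c * (- d / c) + d \<noteq> 0" by (rule F(1))
    then show False using \<open>c \<noteq> 0\<close> by simp
  qed
  moreover have "F y - F x = (y - x) * (a * d - b * c) / ((c * x + d) * (c * y + d))"
    unfolding F(2)[OF assms(3)] F(2)[OF assms(4)]
    by (subst diff_frac_eq) (use F(1)[OF assms(3)] F(1)[OF assms(4)] in \<open>simp_all add: algebra_simps\<close>)
  ultimately show ?thesis using \<open>x < y\<close> det by (smt (verit) divide_pos_pos mult_cancel_left1 mult.commute)
qed

text \<open>The composite has the product matrix, and its denominator at x is the product of the
  denominators at x and at \<open>G x\<close>.\<close>

lemma mobius_on_comp:
  assumes "mobius_on J G" "mobius_on (G ` J) F"
  shows "mobius_on J (F \<circ> G)"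
proof -
  obtain a b c d where det: "a * d - b * c = 1"
    and G: "\<And>x. x \<in> J \<Longrightarrow> c * x + d \<noteq> 0" "\<And>x. x \<in> J \<Longrightarrow> G x = (a * x + b) / (c * x + d)"
    using assms(1) unfolding mobius_on_def by blast
  obtain a' b' c' d' where det': "a' * d' - b' * c' = 1"
    and F: "\<And>x. x \<in> J \<Longrightarrow> c' * G x + d' \<noteq> 0"
      "\<And>x. x \<in> J \<Longrightarrow> F (G x) = (a' * G x + b') / (c' * G x + d')"
    using assms(2) unfolding mobius_on_def by blast
  have "(a' * a + b' * c) * (c' * b + d' * d) - (a' * b + b' * d) * (c' * a + d' * c)
      = (a' * d' - b' * c') * (a * d - b * c)" by (simp add: algebra_simps)
  then have "(a' * a + b' * c) * (c' * b + d' * d) - (a' * b + b' * d) * (c' * a + d' * c) = 1"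
    using det det' by simp
  moreover have "(c' * a + d' * c) * x + (c' * b + d' * d) \<noteq> 0 \<and>
      (F \<circ> G) x = ((a' * a + b' * c) * x + (a' * b + b' * d)) / ((c' * a + d' * c) * x + (c' * b + d' * d))"
    if "x \<in> J" for x
  proof -
    have den: "(c' * a + d' * c) * x + (c' * b + d' * d) = (c * x + d) * (c' * G x + d')"
      and num: "(a' * a + b' * c) * x + (a' * b + b' * d) = (c * x + d) * (a' * G x + b')"
      using G[OF that] by (simp_all add: field_simps)
    show ?thesis unfolding den num using G(1)[OF that] F[OF that] by simp
  qed
  ultimately show ?thesis unfolding mobius_on_def by blast
qed

text \<open>The inverse has the adjugate matrix; its denominator at \<open>G x\<close> is 1 / (c x +
  d), so it has no pole on the image.\<close>

lemma mobius_on_inverse: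
  assumes "mobius_on J G" "\<And>x. x \<in> J \<Longrightarrow> F (G x) = x"
  shows "mobius_on (G ` J) F"
proof -
  obtain a b c d where det: "a * d - b * c = 1"
    and G: "\<And>x. x \<in> J \<Longrightarrow> c * x + d \<noteq> 0" "\<And>x. x \<in> J \<Longrightarrow> G x = (a * x + b) / (c * x + d)"
    using assms(1) unfolding mobius_on_def by blast
  have "- c * y + a \<noteq> 0 \<and> F y = (d * y + - b) / (- c * y + a)" if "y \<in> G ` J" for y
  proof -
    from that obtain x where x: "x \<in> J" "y = G x" ..
    have "- c * y + a = (a * d - b * c) / (c * x + d)"
      and "d * y + - b = (a * d - b * c) * x / (c * x + d)"
      using G[OF x(1)] unfolding x(2) by (simp_all add: field_simps)
    then show ?thesis using assms(2)[OF x(1)] G(1)[OF x(1)] det x(2) by simp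
  qed
  moreover have "d * a - - b * - c = 1" using det by (simp add: algebra_simps)
  ultimately show ?thesis unfolding mobius_on_def by blast
qed

lemma convex_image_strict_mono:
  fixes G :: "real \<Rightarrow> real"
  assumes "strict_mono G" "surj G" "convex J"
  shows "convex (G ` J)"
  unfolding convex_real_iff
proof (intro ballI allI impI)
  fix x y z assume "x \<in> G ` J" "z \<in> G ` J" "x \<le> y" "y \<le> z"
  moreover obtain u where "y = G u" using \<open>surj G\<close> by (meson surjD)
  ultimately show "y \<in> G ` J"
    using assms(3) unfolding convex_real_iff
    by (auto simp: strict_mono_less_eq[OF assms(1)])
qed

lemma inv_into_strict_mono_surj:
  fixes F :: "real \<Rightarrow> real"
  assumes "strict_mono F" "surj F"
  shows "inv_into UNIV F (F x) = x" "F (inv_into UNIV F x) = x"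
proof -
  show "inv_into UNIV F (F x) = x" using assms(1) by (intro inv_f_f strict_mono_imp_inj_on)
  show "F (inv_into UNIV F x) = x" using assms(2) by (rule surj_f_inv_f)
qed

lemma strict_mono_surj_inverse:
  fixes F :: "real \<Rightarrow> real"
  assumes "strict_mono F" "surj F"
  shows "strict_mono (inv_into UNIV F)" "surj (inv_into UNIV F)"
proof -
  show "strict_mono (inv_into UNIV F)"
  proof (rule strict_monoI)
    fix x y :: real assume "x < y"
    then show "inv_into UNIV F x < inv_into UNIV F y"
      using inv_into_strict_mono_surj(2)[OF assms] strict_mono_less[OF assms(1)] by metis
  qed
  show "surj (inv_into UNIV F)" using inv_into_strict_mono_surj(1)[OF assms] by (metis surjI)
qed

lemma PM_comp:
  assumes "F \<in> PM" "G \<in> PM"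
  shows "F \<circ> G \<in> PM"
proof -
  obtain A where A: "finite A" "\<And>J. convex J \<Longrightarrow> J \<inter> A = {} \<Longrightarrow> mobius_on J F"
    using assms(1) unfolding PM_def pw_mobius_def by blast
  obtain B where B: "finite B" "\<And>J. convex J \<Longrightarrow> J \<inter> B = {} \<Longrightarrow> mobius_on J G"
    using assms(2) unfolding PM_def pw_mobius_def by blast
  have G: "strict_mono G" "surj G" using assms(2) unfolding PM_def by auto
  \<comment> \<open>The composite can break where \<open>G\<close> does and where \<open>G\<close>
    reaches a break point of \<open>F\<close>; injectivity of \<open>G\<close> keeps the latter set
    finite.\<close>
  have "finite (B \<union> G -` A)" using A(1) B(1) G(1)
    by (simp add: finite_vimageI strict_mono_imp_inj_on)
  moreover have "mobius_on J (F \<circ> G)" if "convex J" "J \<inter> (B \<union> G -` A) = {}" for J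
  proof (rule mobius_on_comp)
    show "mobius_on J G" using B(2) that by blast
    show "mobius_on (G ` J) F" using that by (intro A(2) convex_image_strict_mono G) auto
  qed
  ultimately have "pw_mobius (F \<circ> G)" unfolding pw_mobius_def by blast
  moreover have "strict_mono (F \<circ> G)" using assms unfolding PM_def by (simp add: strict_mono_def)
  moreover have "surj (F \<circ> G)" using assms comp_surj[of G F] unfolding PM_def by blast
  ultimately show ?thesis unfolding PM_def by blast
qed

lemma PM_inverse:
  assumes "F \<in> PM"
  shows "inv_into UNIV F \<in> PM"
proof -
  let ?G = "inv_into UNIV F"
  obtain A where A: "finite A" "\<And>J. convex J \<Longrightarrow> J \<inter> A = {} \<Longrightarrow> mobius_on J F"
    using assms unfolding PM_def pw_mobius_def by blast
  have F: "strict_mono F" "surj F" using assms unfolding PM_def by auto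
  note inv_simps = inv_into_strict_mono_surj[OF F] and G = strict_mono_surj_inverse[OF F]
  have "mobius_on J ?G" if "convex J" "J \<inter> F ` A = {}" for J
  proof -
    have "mobius_on (?G ` J) F"
      using that by (intro A(2) convex_image_strict_mono G) (auto simp: inv_simps image_iff, metis disjoint_iff imageI inv_simps(2))
    then have "mobius_on (F ` ?G ` J) ?G" by (rule mobius_on_inverse) (simp add: inv_simps)
    then show ?thesis by (simp add: image_image inv_simps)
  qed
  then have "pw_mobius ?G" using A(1) unfolding pw_mobius_def by (meson finite_imageI)
  then show ?thesis using G unfolding PM_def by auto
qed

section \<open>Passing between H and maps of the line\<close>

definition on_line :: "(P1 \<Rightarrow> P1) \<Rightarrow> real \<Rightarrow> real" where
  "on_line f = coord \<circ> f \<circ> chart"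

lemma Hset_bij: "f \<in> Hset \<Longrightarrow> bij f"
  unfolding Hset_def Gset_def homeomorphism_def by (auto intro!: bijI') metis

lemma Hset_infty [simp]: "f \<in> Hset \<Longrightarrow> f infty = infty"
  unfolding Hset_def by simp

lemma chart_on_line:
  assumes "f infty = infty" "inj f"
  shows "chart (on_line f x) = f (chart x)"
proof -
  have "f (chart x) \<noteq> infty" using assms by (metis chart_neq_infty(1) injD)
  then show ?thesis unfolding on_line_def by (simp add: chart_coord)
qed

lemma chart_on_line_H: "f \<in> Hset \<Longrightarrow> chart (on_line f x) = f (chart x)"
  using chart_on_line Hset_bij bij_is_inj Hset_infty by metis

lemma on_line_inject:
  assumes "f \<in> Hset" "g \<in> Hset" "on_line f = on_line g"
  shows "f = g"
proof
  fix p show "f p = g p"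
    using assms chart_on_line_H by (cases p rule: P1_cases) (auto, metis)
qed

lemma on_line_id [simp]: "on_line id = id"
  unfolding on_line_def by auto

lemma on_line_comp:
  assumes "g infty = infty" "inj g"
  shows "on_line (f \<circ> g) = on_line f \<circ> on_line g"
  using chart_on_line[OF assms] by (auto simp: on_line_def)

lemma open_chart_image:
  assumes "open B"
  shows "open (chart ` B)"
proof (subst open_subopen, intro ballI)
  fix p assume "p \<in> chart ` B"
  then obtain x where x: "x \<in> B" "p = chart x" by blast
  then obtain e where "e > 0" "ball x e \<subseteq> B" using assms open_contains_ball by blast
  then have "p \<in> chart ` {x - e<..<x + e}" "chart ` {x - e<..<x + e} \<subseteq> chart ` B"
    using x by (auto simp: ball_eq_greaterThanLessThan)
  then show "\<exists>T. open T \<and> p \<in> T \<and> T \<subseteq> chart ` B" using open_chart_interval by meson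
qed

lemma continuous_on_line:
  assumes "f \<in> Hset"
  shows "continuous_on UNIV (on_line f)"
  unfolding continuous_on_open_vimage[OF open_UNIV]
proof (intro allI impI)
  fix B :: "real set" assume "open B"
  have "continuous_on UNIV f" using assms unfolding Hset_def Gset_def homeomorphism_def by auto
  then have "open (f -` (chart ` B))"
    using open_chart_image[OF \<open>open B\<close>] by (rule open_vimage[rotated])
  then have "open (chart -` (f -` (chart ` B)))"
    using continuous_chart by (rule open_vimage)
  moreover have "chart -` (f -` (chart ` B)) = on_line f -` B"
    using chart_on_line_H[OF assms] by (auto simp: image_iff simp flip: chart_on_line_H[OF assms])
  ultimately show "open (on_line f -` B \<inter> UNIV)" by simp
qed

text \<open>The break points are the frontier points of the pieces pulled back to the line. A
  connected set that avoids them lies inside every piece it meets. There is no pole on it, because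
  \<open>f\<close> sends only \<open>infty\<close> to \<open>infty\<close>.\<close>

lemma on_line_pw_mobius:
  assumes "f \<in> Hset"
  shows "pw_mobius (on_line f)"
proof -
  obtain I where I: "finite I" "\<Union>I = UNIV"
    and S: "\<And>S. S \<in> I \<Longrightarrow> connected S" "\<And>S. S \<in> I \<Longrightarrow> \<exists>h\<in>PSL2. \<forall>x\<in>S. f x = h x"
    using assms unfolding Hset_def Gset_def piecewise_PSL2_def by blast
  define B where "B = (\<Union>S\<in>I. frontier (chart -` S))"
  have "finite (frontier (chart -` S))" if "S \<in> I" for S
    using connected_P1_chart[OF S(1)[OF that]] finite_frontier_convex_real[of "chart -` S"]
      finite_frontier_convex_real[of "- (chart -` S)"] by (auto simp: frontier_complement)
  then have "finite B" using I(1) unfolding B_def by blast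
  moreover have "mobius_on J (on_line f)" if J: "convex J" "J \<inter> B = {}" for J
  proof (cases "J = {}")
    case False
    then obtain x where "x \<in> J" by blast
    have "chart x \<in> \<Union>I" using I(2) by simp
    then obtain S' where S': "S' \<in> I" "chart x \<in> S'" by blast
    then have sub: "J \<subseteq> chart -` S'"
      using connected_Int_frontier[of J "chart -` S'"] J convex_connected[OF J(1)] \<open>x \<in> J\<close>
      unfolding B_def by blast
    obtain a b c d where det: "a * d - b * c = 1" and h: "\<And>p. p \<in> S' \<Longrightarrow> f p = proj_map a b c d p"
      using S(2)[OF S'(1)] unfolding PSL2_def by blast
    have "c * y + d \<noteq> 0 \<and> on_line f y = (a * y + b) / (c * y + d)" if "y \<in> J" for y
    proof -
      have "chart (on_line f y) = proj_map a b c d (chart y)"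
        using h sub that chart_on_line_H[OF assms] by auto
      then show ?thesis unfolding proj_map_chart[OF det] by (auto split: if_splits)
    qed
    then show ?thesis using det unfolding mobius_on_def by blast
  qed (simp add: mobius_on_empty)
  ultimately show ?thesis unfolding pw_mobius_def by blast
qed

text \<open>A continuous injection of the line is monotone. It is increasing because it increases on
  an interval without break points, where it is a Moebius map of determinant one.\<close>

lemma on_line_PM:
  assumes "f \<in> Hset"
  shows "on_line f \<in> PM"
proof -
  let ?F = "on_line f"
  have inj: "inj ?F"
    using chart_on_line_H[OF assms] bij_is_inj[OF Hset_bij[OF assms]]
    by (metis (no_types, lifting) chart_eq_iff injD injI)
  have "surj ?F"
  proof (rule surjI)
    fix y
    have "\<exists>p. f p = chart y" using Hset_bij[OF assms] by (metis bij_pointE)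
    then obtain p where "f p = chart y" ..
    moreover from this have "p \<noteq> infty" using assms by auto
    ultimately have "chart (?F (coord p)) = chart y" by (simp add: chart_on_line_H[OF assms] chart_coord)
    then have "\<exists>x. ?F x = y" by auto
    then show "?F (SOME x. ?F x = y) = y" by (rule someI_ex)
  qed
  have pw: "pw_mobius ?F" by (rule on_line_pw_mobius[OF assms])
  then obtain B where B: "finite B" "\<And>J. convex J \<Longrightarrow> J \<inter> B = {} \<Longrightarrow> mobius_on J ?F"
    unfolding pw_mobius_def by blast
  define M where "M = Max (insert 0 B) + 1"
  have "b < M" if "b \<in> B" for b
    using Max_ge[of "insert 0 B" b] B(1) that unfolding M_def by (smt (verit) finite_insert insertCI)
  then have "mobius_on {M..M+1} ?F" by (intro B(2)) force+
  then have "?F M < ?F (M + 1)" by (rule mobius_on_increasing) auto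
  moreover have "strict_mono_on UNIV ?F \<or> strict_antimono_on UNIV ?F"
    using injective_eq_monotone_map[of UNIV ?F] continuous_on_line[OF assms] inj is_interval_univ by blast
  ultimately have "strict_mono ?F" by (auto simp: monotone_on_def) (smt (verit))
  with \<open>surj ?F\<close> pw show ?thesis unfolding PM_def by simp
qed

text \<open>The way back from the line, which gives closure of \<open>Hset\<close> under composition
  and inverses. The pieces are \<open>infty\<close>, the single break points and the components
  between them.\<close>

lemma Hset_I:
  assumes homeo: "homeomorphism UNIV UNIV f g" and "f infty = infty" and "pw_mobius (on_line f)"
  shows "f \<in> Hset"
proof -
  obtain B where B: "finite B" "\<And>J. convex J \<Longrightarrow> J \<inter> B = {} \<Longrightarrow> mobius_on J (on_line f)"
    using assms(3) unfolding pw_mobius_def by blast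
  have inj: "inj f" using homeo unfolding homeomorphism_def by (metis UNIV_I injI)
  note chart_f = chart_on_line[OF assms(2) inj]
  let ?P = "\<lambda>S. connected S \<and> (\<exists>h\<in>PSL2. \<forall>x\<in>S. f x = h x)"
  define I where "I = insert {infty} ((\<lambda>b. {chart b}) ` B \<union> (\<lambda>Z. chart ` gap B Z) ` Pow B)"
  have "finite I" unfolding I_def using B(1) by simp
  moreover have "\<Union>I = UNIV"
  proof -
    have "p \<in> \<Union>I" for p
    proof (cases p rule: P1_cases)
      case (2 x)
      then show ?thesis
        using cut_in_Pow[of B x] unfolding I_def by (cases "x \<in> B") (auto simp: gap_def)
    qed (simp add: I_def)
    then show ?thesis by blast
  qed
  moreover have "?P S" if "S \<in> I" for S
  proof -
    have "S = {infty} \<or> (\<exists>b. S = {chart b}) \<or> (\<exists>Z. S = chart ` gap B Z)"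
      using that unfolding I_def by blast
    then consider "S = {infty}" | b where "S = {chart b}" | Z where "S = chart ` gap B Z" by metis
    then show ?thesis
    proof cases
      case 1
      have "id \<in> PSL2" unfolding PSL2_def using proj_map_id[symmetric] by force
      moreover have "\<forall>x\<in>S. f x = id x" using 1 assms(2) by simp
      ultimately show ?thesis using 1 connected_sing by blast
    next
      case 2
      \<comment> \<open>A one-point piece only needs the right value at that point, and a
        translation supplies it.\<close>
      let ?t = "on_line f b - b"
      have "proj_map 1 ?t 0 1 \<in> PSL2" unfolding PSL2_def by force
      moreover have "f (chart b) = proj_map 1 ?t 0 1 (chart b)"
        by (subst proj_map_chart) (simp_all add: chart_f)
      then have "\<forall>x\<in>S. f x = proj_map 1 ?t 0 1 x" using 2 by simp
      ultimately show ?thesis using 2 connected_sing by blast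
    next
      case 3
      have "connected S" unfolding 3
        using continuous_chart convex_gap[THEN convex_connected]
        by (intro connected_continuous_image) (auto intro: continuous_on_subset)
      obtain a b c d where det: "a * d - b * c = 1" and
        F: "\<And>x. x \<in> gap B Z \<Longrightarrow> c * x + d \<noteq> 0 \<and> on_line f x = (a * x + b) / (c * x + d)"
        using B(2)[OF convex_gap gap_disjoint] unfolding mobius_on_def by blast
      have "f p = proj_map a b c d p" if "p \<in> S" for p
      proof -
        from that obtain x where x: "x \<in> gap B Z" "p = chart x" unfolding 3 ..
        then show ?thesis using F[OF x(1)] chart_f[of x] by (simp add: proj_map_chart[OF det])
      qed
      moreover have "proj_map a b c d \<in> PSL2" unfolding PSL2_def using det by blast
      ultimately show ?thesis using \<open>connected S\<close> by blast
    qed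
  qed
  ultimately have "piecewise_PSL2 f" unfolding piecewise_PSL2_def by (intro exI[of _ I] conjI ballI) simp_all
  then show ?thesis using homeo assms(2) unfolding Hset_def Gset_def by blast
qed

lemma Hset_comp:
  assumes "f \<in> Hset" "g \<in> Hset"
  shows "f \<circ> g \<in> Hset"
proof -
  obtain f' g' where "homeomorphism UNIV UNIV f f'" "homeomorphism UNIV UNIV g g'"
    using assms unfolding Hset_def Gset_def by blast
  then have "homeomorphism UNIV UNIV (f \<circ> g) (g' \<circ> f')" by (rule homeomorphism_compose[rotated])
  moreover have "pw_mobius (on_line (f \<circ> g))"
    using PM_comp[OF on_line_PM[OF assms(1)] on_line_PM[OF assms(2)]] Hset_bij[OF assms(2)] assms(2)
    by (simp add: on_line_comp bij_is_inj PM_def)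
  ultimately show ?thesis using assms by (intro Hset_I) auto
qed

lemma Hset_inverse:
  assumes "f \<in> Hset"
  shows "inv_into UNIV f \<in> Hset" "on_line (inv_into UNIV f) = inv_into UNIV (on_line f)"
proof -
  let ?g = "inv_into UNIV f"
  obtain g where homeo: "homeomorphism UNIV UNIV f g"
    using assms unfolding Hset_def Gset_def by blast
  then have "?g = g" by (intro inv_equality) (simp_all add: homeomorphism_def)
  then have g: "homeomorphism UNIV UNIV ?g f" using homeomorphism_symD[OF homeo] by simp
  have inj: "inj f" using bij_is_inj[OF Hset_bij[OF assms]] .
  have g_inf: "?g infty = infty" using inv_f_f[OF inj, of infty] assms by simp
  have "on_line ?g \<circ> on_line f = id"
    using on_line_comp[of f ?g] inj assms by simp
  then have inv: "on_line ?g (on_line f x) = x" for x by (metis comp_apply id_apply)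
  have "on_line ?g y = inv_into UNIV (on_line f) y" for y
    using inv_into_strict_mono_surj(2)[of "on_line f" y] on_line_PM[OF assms] inv[of "inv_into UNIV (on_line f) y"]
    unfolding PM_def by simp
  then show eq: "on_line ?g = inv_into UNIV (on_line f)" by blast
  show "?g \<in> Hset" using g g_inf PM_inverse[OF on_line_PM[OF assms]]
    by (intro Hset_I) (auto simp: eq PM_def)
qed

lemma id_Hset: "id \<in> Hset"
proof (rule Hset_I)
  have "mobius_on J id" for J
    unfolding mobius_on_def by (rule exI[of _ 1], rule exI[of _ 0], rule exI[of _ 0], rule exI[of _ 1]) simp
  then show "pw_mobius (on_line id)" unfolding pw_mobius_def by auto
  show "homeomorphism UNIV UNIV (id :: P1 \<Rightarrow> P1) id" by (simp add: homeomorphism_def id_def)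
qed simp

subsection \<open>Germs at the ends and fixed points\<close>

text \<open>In the coordinate \<tau>, the germ of \<open>F\<close> along the filter is t \<mapsto>
  \<alpha> t + \<beta>. Comparing \<tau> (F x) with \<tau> x avoids an inverse of \<tau>.\<close>

definition affine_germ :: "real filter \<Rightarrow> (real \<Rightarrow> real) \<Rightarrow> real \<Rightarrow> real \<Rightarrow> (real \<Rightarrow> real) \<Rightarrow> bool" where
  "affine_germ \<F> \<tau> \<alpha> \<beta> F \<longleftrightarrow> (\<forall>\<^sub>F x in \<F>. \<tau> (F x) = \<alpha> * \<tau> x + \<beta>)"

lemma affine_germ_comp:
  assumes "affine_germ \<F> \<tau> \<alpha> \<beta> F" "affine_germ \<F> \<tau> \<alpha>' \<beta>' G" "filterlim G \<F> \<F>"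
  shows "affine_germ \<F> \<tau> (\<alpha> * \<alpha>') (\<alpha> * \<beta>' + \<beta>) (F \<circ> G)"
proof -
  have "\<forall>\<^sub>F x in \<F>. \<tau> (F (G x)) = \<alpha> * \<tau> (G x) + \<beta>"
    using assms(1,3) unfolding affine_germ_def by (rule eventually_compose_filterlim)
  then show ?thesis
    using assms(2) unfolding affine_germ_def by eventually_elim (simp add: algebra_simps)
qed

lemma affine_germ_inverse:
  assumes "affine_germ \<F> \<tau> \<alpha> \<beta> F" "\<alpha> \<noteq> 0" "filterlim G \<F> \<F>" "\<And>x. F (G x) = x"
  shows "affine_germ \<F> \<tau> (1 / \<alpha>) (- \<beta> / \<alpha>) G"
proof -
  have "\<forall>\<^sub>F x in \<F>. \<tau> (F (G x)) = \<alpha> * \<tau> (G x) + \<beta>"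
    using assms(1,3) unfolding affine_germ_def by (rule eventually_compose_filterlim)
  then show ?thesis
    unfolding affine_germ_def by eventually_elim (use assms(2,4) in \<open>simp add: field_simps\<close>)
qed

text \<open>The linear parts cancel in a commutator, so a translation remains. Its length is
  recorded because it vanishes when both germs are already translations.\<close>

lemma affine_germ_commutator:
  assumes F: "affine_germ \<F> \<tau> \<alpha> \<beta> F" "\<alpha> \<noteq> 0" "filterlim F \<F> \<F>" "filterlim F' \<F> \<F>" "\<And>x. F (F' x) = x"
    and G: "affine_germ \<F> \<tau> \<alpha>' \<beta>' G" "\<alpha>' \<noteq> 0" "filterlim G \<F> \<F>" "filterlim G' \<F> \<F>" "\<And>x. G (G' x) = x"
  shows "affine_germ \<F> \<tau> 1 (\<alpha> * \<beta>' + \<beta> - \<alpha>' * \<beta> - \<beta>') (F \<circ> G \<circ> F' \<circ> G')"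
proof -
  note F' = affine_germ_inverse[OF F(1,2,4,5)] and G' = affine_germ_inverse[OF G(1,2,4,5)]
  show ?thesis
    using affine_germ_comp[OF affine_germ_comp[OF affine_germ_comp[OF F(1) G(1,3)] F' F(4)] G' G(4)] F(2) G(2)
    by (simp add: field_simps)
qed

text \<open>Each end carries a coordinate in which the germs of Moebius maps fixing it are affine.\<close>

definition ends :: "real set \<Rightarrow> (real filter \<times> (real \<Rightarrow> real)) set" where
  "ends E = {(at_top, id), (at_bot, id)} \<union>
     (\<Union>e\<in>E. {(at_right e, \<lambda>x. 1 / (x - e)), (at_left e, \<lambda>x. 1 / (x - e))})"

lemma ends_cases:
  assumes "(\<F>, \<tau>) \<in> ends E"
  obtains "\<F> = at_top" "\<tau> = id" | "\<F> = at_bot" "\<tau> = id"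
  | e where "e \<in> E" "\<F> = at_right e" "\<tau> = (\<lambda>x. 1 / (x - e))"
  | e where "e \<in> E" "\<F> = at_left e" "\<tau> = (\<lambda>x. 1 / (x - e))"
  using assms unfolding ends_def by blast

text \<open>At a finite end \<open>e\<close> this includes the point \<open>e\<close> itself: there
  the coordinate is 1 / 0 = 0, a value taken nowhere else.\<close>

lemma ends_inject:
  assumes "(\<F>, \<tau>) \<in> ends E"
  shows "\<tau> x = \<tau> y \<longleftrightarrow> x = y"
  using assms by (cases rule: ends_cases) auto

lemma continuous_strict_mono_surj:
  fixes F :: "real \<Rightarrow> real"
  assumes "strict_mono F" "surj F"
  shows "continuous_on UNIV F"
  using assms by (intro continuous_onI_mono) (auto simp: strict_mono_less_eq)

lemma tendsto_strict_mono_surj: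
  fixes F :: "real \<Rightarrow> real"
  assumes "strict_mono F" "surj F"
  shows "(F \<longlongrightarrow> F e) (at e within S)"
  using continuous_strict_mono_surj[OF assms] continuous_on_subset
  unfolding continuous_on_def by (metis UNIV_I tendsto_within_subset subset_UNIV)

text \<open>An increasing map that fixes \<open>e\<close> preserves both sides of \<open>e\<close>;
  at the infinite ends surjectivity makes the values unbounded.\<close>

lemma filterlim_ends:
  assumes F: "strict_mono F" "surj F" and fixE: "\<And>e. e \<in> E \<Longrightarrow> F e = e"
    and "(\<F>, \<tau>) \<in> ends E"
  shows "filterlim F \<F> \<F>"
  using assms(4)
proof (cases rule: ends_cases)
  case 1
  have "\<forall>\<^sub>F x in at_top. y \<le> F x" for y
  proof -
    obtain x where "y = F x" using F(2) by (meson surjD)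
    then show ?thesis
      using eventually_ge_at_top[of x] by (auto elim!: eventually_mono simp: strict_mono_less_eq[OF F(1)])
  qed
  then show ?thesis unfolding 1 by (simp add: filterlim_at_top)
next
  case 2
  have "\<forall>\<^sub>F x in at_bot. F x \<le> y" for y
  proof -
    obtain x where "y = F x" using F(2) by (meson surjD)
    then show ?thesis
      using eventually_le_at_bot[of x] by (auto elim!: eventually_mono simp: strict_mono_less_eq[OF F(1)])
  qed
  then show ?thesis unfolding 2 by (simp add: filterlim_at_bot)
next
  case (3 e)
  have "\<forall>\<^sub>F x in at_right e. F x \<in> {e<..} \<and> F x \<noteq> e"
    using eventually_at_right_less[of e] fixE[OF 3(1)] strict_mono_less[OF F(1), of e]
    by (auto elim!: eventually_mono)
  then show ?thesis
    unfolding 3 filterlim_at using tendsto_strict_mono_surj[OF F, of e] fixE[OF 3(1)] by simp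
next
  case (4 e)
  have "\<forall>\<^sub>F x in at_left e. x < e" by (simp add: eventually_at_filter)
  then have "\<forall>\<^sub>F x in at_left e. F x \<in> {..<e} \<and> F x \<noteq> e"
    using fixE[OF 4(1)] strict_mono_less[OF F(1), of _ e]
    by (auto elim!: eventually_mono)
  then show ?thesis
    unfolding 4 filterlim_at using tendsto_strict_mono_surj[OF F, of e] fixE[OF 4(1)] by simp
qed

text \<open>The coordinate 1 / (x - e) moves \<open>e\<close> to infinity, and a Moebius map that
  fixes infinity is affine.\<close>

lemma mobius_germ_fixed_point:
  assumes "mobius_on J F" "\<forall>\<^sub>F x in at e within S. x \<in> J" "at e within S \<noteq> bot"
    "(F \<longlongrightarrow> e) (at e within S)"
  shows "\<exists>\<alpha> \<beta>. \<alpha> \<noteq> 0 \<and> affine_germ (at e within S) (\<lambda>x. 1 / (x - e)) \<alpha> \<beta> F"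
proof -
  obtain a b c d where det: "a * d - b * c = 1"
    and F: "\<And>x. x \<in> J \<Longrightarrow> c * x + d \<noteq> 0" "\<And>x. x \<in> J \<Longrightarrow> F x = (a * x + b) / (c * x + d)"
    using assms(1) unfolding mobius_on_def by blast
  \<comment> \<open>The limit of F x (c x + d) = a x + b shows that the matrix of this piece fixes
    \<open>e\<close>, even if \<open>e\<close> is not in \<open>J\<close>.\<close>
  have "((\<lambda>x. F x * (c * x + d)) \<longlongrightarrow> e * (c * e + d)) (at e within S)"
    by (intro tendsto_intros assms)
  moreover have "((\<lambda>x. F x * (c * x + d)) \<longlongrightarrow> a * e + b) (at e within S)"
  proof (rule Lim_transform_eventually)
    show "((\<lambda>x. a * x + b) \<longlongrightarrow> a * e + b) (at e within S)" by (intro tendsto_intros)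
    show "\<forall>\<^sub>F x in at e within S. a * x + b = F x * (c * x + d)"
      using assms(2) by eventually_elim (simp add: F)
  qed
  ultimately have eq: "e * (c * e + d) = a * e + b"
    using tendsto_unique[OF assms(3)] by blast
  then have b: "b = e * (c * e + d) - a * e" by simp
  \<comment> \<open>With \<open>e\<close> fixed, the determinant splits into these two factors, so
    neither vanishes; in particular \<open>e\<close> is not a pole.\<close>
  have "(a - e * c) * (c * e + d) = 1" using det unfolding b by (simp add: algebra_simps)
  then have nz: "a - e * c \<noteq> 0" "c * e + d \<noteq> 0" by auto
  have "\<forall>\<^sub>F x in at e within S. x \<noteq> e" by (simp add: eventually_at_filter)
  with assms(2) have "\<forall>\<^sub>F x in at e within S.
    1 / (F x - e) = (c * e + d) / (a - e * c) * (1 / (x - e)) + c / (a - e * c)"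
  proof eventually_elim
    case (elim x)
    have "F x - e = (a - e * c) * (x - e) / (c * x + d)"
      using F[OF elim(1)] b by (simp add: field_simps)
    moreover have "c * x + d = (c * e + d) + c * (x - e)" by (simp add: algebra_simps)
    moreover have "1 / (p * t / (q + c * t)) = q / p * (1 / t) + c / p"
      if "p \<noteq> 0" "t \<noteq> 0" for p q t :: real using that by (simp add: field_simps)
    ultimately show ?case using nz(1) elim(2) by (simp del: diff_eq_eq)
  qed
  then show ?thesis using nz unfolding affine_germ_def by (intro exI[of _ "(c * e + d) / (a - e * c)"] exI[of _ "c / (a - e * c)"]) simp
qed

text \<open>If c were nonzero, the values would tend to a / c, whereas \<open>F\<close> tends to
  infinity. So c = 0 and the map is affine.\<close>

lemma mobius_germ_infinity:
  assumes "mobius_on J F" "\<forall>\<^sub>F x in \<F>. x \<in> J" "\<F> = at_top \<or> \<F> = at_bot" "filterlim F \<F> \<F>"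
  shows "\<exists>\<alpha> \<beta>. \<alpha> \<noteq> 0 \<and> affine_germ \<F> id \<alpha> \<beta> F"
proof -
  obtain a b c d where det: "a * d - b * c = 1"
    and F: "\<And>x. x \<in> J \<Longrightarrow> c * x + d \<noteq> 0 \<and> F x = (a * x + b) / (c * x + d)"
    using assms(1) unfolding mobius_on_def by blast
  have nbot: "\<F> \<noteq> bot"
    using assms(3) trivial_limit_at_top_linorder[where 'a = real] trivial_limit_at_bot_linorder[where 'a = real]
    by metis
  have ev: "\<forall>\<^sub>F x in \<F>. (a * x + b) / (c * x + d) = F x"
    using assms(2) by eventually_elim (simp add: F)
  have inf: "filterlim F at_infinity \<F>"
    using assms(3,4) filterlim_at_top_imp_at_infinity filterlim_at_bot_imp_at_infinity by blast
  have "c = 0"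
  proof (rule ccontr)
    assume "c \<noteq> 0"
    then consider "c > 0" | "c < 0" by linarith
    then have "((\<lambda>x. (a * x + b) / (c * x + d)) \<longlongrightarrow> a / c) \<F>"
      using assms(3) by cases (elim disjE; hypsubst; real_asymp simp: field_simps)+
    then have "(F \<longlongrightarrow> a / c) \<F>" using ev by (rule Lim_transform_eventually)
    then show False using not_tendsto_and_filterlim_at_infinity[OF nbot _ inf] by blast
  qed
  then have "a \<noteq> 0" "d \<noteq> 0" using det by auto
  have "\<forall>\<^sub>F x in \<F>. F x = a / d * x + b / d"
    using assms(2) by eventually_elim (simp add: F \<open>c = 0\<close> add_divide_distrib)
  then show ?thesis using \<open>a \<noteq> 0\<close> \<open>d \<noteq> 0\<close> unfolding affine_germ_def by (intro exI[of _ "a / d"] exI[of _ "b / d"]) simp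
qed

text \<open>Sufficiently close to an end there are no further break points, so the germ comes from a
  single Moebius map.\<close>

lemma PM_affine_germ:
  assumes "F \<in> PM" and fixE: "\<And>e. e \<in> E \<Longrightarrow> F e = e" and "(\<F>, \<tau>) \<in> ends E"
  shows "\<exists>\<alpha> \<beta>. \<alpha> \<noteq> 0 \<and> affine_germ \<F> \<tau> \<alpha> \<beta> F"
proof -
  obtain B where B: "finite B" "\<And>J. convex J \<Longrightarrow> J \<inter> B = {} \<Longrightarrow> mobius_on J F"
    using assms(1) unfolding PM_def pw_mobius_def by blast
  have mono: "strict_mono F" "surj F" using assms(1) unfolding PM_def by auto
  obtain M where M: "\<And>b. b \<in> B \<Longrightarrow> \<bar>b\<bar> \<le> M"
    using finite_imp_bounded[OF B(1)] by (auto simp: bounded_iff)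
  note lim = filterlim_ends[OF mono fixE assms(3)]
  from assms(3) show ?thesis
  proof (cases rule: ends_cases)
    case 1
    have "mobius_on {M<..} F" using M by (intro B(2)) (force simp: disjoint_iff)+
    then show ?thesis using mobius_germ_infinity[of "{M<..}" F at_top] lim 1 by simp
  next
    case 2
    have "mobius_on {..<-M} F" using M by (intro B(2)) (force simp: disjoint_iff)+
    then show ?thesis using mobius_germ_infinity[of "{..<-M}" F at_bot] lim 2 by simp
  next
    case (3 e)
    obtain r where r: "r > 0" "\<And>b. b \<in> B \<Longrightarrow> b \<noteq> e \<Longrightarrow> r \<le> dist e b"
      using finite_set_avoid[OF B(1), of e] by blast
    have "mobius_on {e<..<e+r} F" using r(2) by (intro B(2)) (force simp: dist_real_def)+
    moreover have "\<forall>\<^sub>F x in at_right e. x \<in> {e<..<e+r}"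
      using r(1) by (intro eventually_at_right_real) simp
    moreover have "(F \<longlongrightarrow> e) (at_right e)"
      using tendsto_strict_mono_surj[OF mono, of e] fixE[OF 3(1)] by simp
    ultimately show ?thesis unfolding 3 by (intro mobius_germ_fixed_point) auto
  next
    case (4 e)
    obtain r where r: "r > 0" "\<And>b. b \<in> B \<Longrightarrow> b \<noteq> e \<Longrightarrow> r \<le> dist e b"
      using finite_set_avoid[OF B(1), of e] by blast
    have "mobius_on {e-r<..<e} F" using r(2) by (intro B(2)) (force simp: dist_real_def)+
    moreover have "\<forall>\<^sub>F x in at_left e. x \<in> {e-r<..<e}"
      using r(1) by (intro eventually_at_left_real) simp
    moreover have "(F \<longlongrightarrow> e) (at_left e)"
      using tendsto_strict_mono_surj[OF mono, of e] fixE[OF 4(1)] by simp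
    ultimately show ?thesis unfolding 4 by (intro mobius_germ_fixed_point) auto
  qed
qed

section \<open>Fixed point sets have finite frontier\<close>

lemma frontier_disjoint_or_subset:
  assumes "open U" "U \<subseteq> A \<or> U \<inter> A = {}" "x \<in> U"
  shows "x \<notin> frontier A"
  using assms interior_maximal[of U A] interior_maximal[of U "- A"]
  by (auto simp: frontier_def closure_interior)

text \<open>On a piece, the fixed points are the zeros of a quadratic polynomial.\<close>

lemma mobius_on_fixed_points:
  assumes "mobius_on J F"
  shows "finite {x\<in>J. F x = x} \<or> J \<subseteq> {x. F x = x}"
proof -
  obtain a b c d where
    F: "\<And>x. x \<in> J \<Longrightarrow> c * x + d \<noteq> 0 \<and> F x = (a * x + b) / (c * x + d)"
    using assms unfolding mobius_on_def by blast
  have iff: "F x = x \<longleftrightarrow> poly [:- b, d - a, c:] x = 0" if "x \<in> J" for x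
    using F[OF that] by (simp add: field_simps) (auto simp: algebra_simps)
  show ?thesis
  proof (cases "[:- b, d - a, c:] = 0")
    case True
    then show ?thesis using iff by auto
  next
    case False
    have "{x\<in>J. F x = x} \<subseteq> {x. poly [:- b, d - a, c:] x = 0}" using iff by blast
    then show ?thesis using poly_roots_finite[OF False] finite_subset by blast
  qed
qed

text \<open>\<open>A\<close> collects the break points together with the fixed points in gaps that
  have only finitely many. A small ball around any other point lies in one gap and either consists
  of fixed points or contains none, so its centre is not on the frontier.\<close>

lemma finite_frontier_fixed_points:
  assumes "F \<in> PM"
  shows "finite (frontier {x. F x = x})"
proof -
  let ?Fix = "{x. F x = x}"
  obtain B where B: "finite B" "\<And>J. convex J \<Longrightarrow> J \<inter> B = {} \<Longrightarrow> mobius_on J F"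
    using assms(1) unfolding PM_def pw_mobius_def by blast
  define A where "A = B \<union> (\<Union>Z\<in>{Z\<in>Pow B. finite (gap B Z \<inter> ?Fix)}. gap B Z \<inter> ?Fix)"
  have "finite A" unfolding A_def using B(1) by (intro finite_UnI finite_UN_I) auto
  moreover have "frontier ?Fix \<subseteq> A"
  proof
    fix x assume x: "x \<in> frontier ?Fix"
    show "x \<in> A"
    proof (rule ccontr)
      assume "x \<notin> A"
      obtain r where r: "r > 0" "\<And>y. y \<in> A \<Longrightarrow> y \<noteq> x \<Longrightarrow> r \<le> dist x y"
        using finite_set_avoid[OF \<open>finite A\<close>, of x] by blast
      have ball: "ball x r \<inter> A = {}" using r(2) \<open>x \<notin> A\<close> by force
      define Z where "Z = cut B x"
      have "ball x r \<subseteq> gap B Z"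
      proof
        fix y assume y: "y \<in> ball x r"
        have "e < y \<longleftrightarrow> e < x" if "e \<in> B" for e
        proof -
          have "r \<le> dist x e" using r(2)[of e] that \<open>x \<notin> A\<close> unfolding A_def by blast
          then show ?thesis using y by (auto simp: dist_real_def)
        qed
        then show "y \<in> gap B Z" using y ball unfolding gap_def Z_def cut_def A_def by auto
      qed
      moreover have "finite (gap B Z \<inter> ?Fix) \<or> gap B Z \<subseteq> ?Fix"
        using mobius_on_fixed_points[OF B(2)[OF convex_gap[of B Z] gap_disjoint]]
        by (simp add: Collect_conj_eq)
      moreover have "gap B Z \<inter> ?Fix \<subseteq> A" if "finite (gap B Z \<inter> ?Fix)"
        using that cut_in_Pow[of B x] unfolding A_def Z_def by blast
      ultimately have "ball x r \<subseteq> ?Fix \<or> ball x r \<inter> ?Fix = {}" using ball by blast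
      then show False using x r(1) frontier_disjoint_or_subset[of "ball x r" ?Fix x] by simp
    qed
  qed
  ultimately show ?thesis by (rule finite_subset[rotated])
qed

subsection \<open>Displacing supports\<close>

definition trivial_at_ends :: "real set \<Rightarrow> (real \<Rightarrow> real) \<Rightarrow> bool" where
  "trivial_at_ends E F \<longleftrightarrow> (\<forall>(\<F>, \<tau>)\<in>ends E. \<forall>\<^sub>F x in \<F>. F x = x)"

lemma trivial_at_ends_comp:
  assumes "trivial_at_ends E F" "trivial_at_ends E G"
  shows "trivial_at_ends E (F \<circ> G)"
  unfolding trivial_at_ends_def
proof (intro ballI, clarify)
  fix \<F> \<tau> assume "(\<F>, \<tau>) \<in> ends E"
  then have "\<forall>\<^sub>F x in \<F>. F x = x" "\<forall>\<^sub>F x in \<F>. G x = x"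
    using assms unfolding trivial_at_ends_def by auto
  then show "\<forall>\<^sub>F x in \<F>. (F \<circ> G) x = x" by eventually_elim simp
qed

lemma trivial_at_ends_conjugate:
  assumes "trivial_at_ends E F"
    and lim: "\<And>\<F> \<tau>. (\<F>, \<tau>) \<in> ends E \<Longrightarrow> filterlim G \<F> \<F>" and "\<And>x. H (G x) = x"
  shows "trivial_at_ends E (H \<circ> F \<circ> G)"
  unfolding trivial_at_ends_def
proof (intro ballI, clarify)
  fix \<F> \<tau> assume mem: "(\<F>, \<tau>) \<in> ends E"
  then have "\<forall>\<^sub>F x in \<F>. F x = x" using assms(1) unfolding trivial_at_ends_def by auto
  then have "\<forall>\<^sub>F x in \<F>. F (G x) = G x" using lim[OF mem] by (rule eventually_compose_filterlim)
  then show "\<forall>\<^sub>F x in \<F>. (H \<circ> F \<circ> G) x = x" by eventually_elim (simp add: assms(3))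
qed

lemma trivial_at_ends_inverse:
  assumes "trivial_at_ends E F" "\<And>x. G (F x) = x"
  shows "trivial_at_ends E G"
  unfolding trivial_at_ends_def
proof (intro ballI, clarify)
  fix \<F> \<tau> assume "(\<F>, \<tau>) \<in> ends E"
  then have "\<forall>\<^sub>F x in \<F>. F x = x" using assms(1) unfolding trivial_at_ends_def by auto
  then show "\<forall>\<^sub>F x in \<F>. G x = x" by eventually_elim (metis assms(2))
qed

text \<open>The support argument is about order and fixed points only. Of the piecewise Moebius
  structure, just the finiteness of \<open>E\<close> enters here.\<close>

locale line_action =
  fixes K :: "(real \<Rightarrow> real) set" and f g :: "real \<Rightarrow> real" and C E :: "real set"
  assumes C_def: "C = {x. f x = x \<and> g x = x}" and E_def: "E = frontier C"
    and mono: "k \<in> K \<Longrightarrow> strict_mono k"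
    and surj: "k \<in> K \<Longrightarrow> surj k"
    and comp: "h \<in> K \<Longrightarrow> k \<in> K \<Longrightarrow> h \<circ> k \<in> K"
    and inverse: "k \<in> K \<Longrightarrow> inv_into UNIV k \<in> K"
    and gens: "f \<in> K" "g \<in> K"
    and fixed: "k \<in> K \<Longrightarrow> x \<in> C \<Longrightarrow> k x = x"
    and finite_E: "finite E"
begin

abbreviation inverse_of :: "(real \<Rightarrow> real) \<Rightarrow> real \<Rightarrow> real" where
  "inverse_of k \<equiv> inv_into UNIV k"

lemma inverse_of [simp]:
  assumes "k \<in> K"
  shows "inverse_of k (k x) = x" "k (inverse_of k x) = x"
  using inv_into_strict_mono_surj[OF mono[OF assms] surj[OF assms]] by auto

lemma less_iff: "k \<in> K \<Longrightarrow> k x < k y \<longleftrightarrow> x < y"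
  using mono strict_mono_less by blast

lemma inj_iff: "k \<in> K \<Longrightarrow> k x = k y \<longleftrightarrow> x = y"
  using mono strict_mono_eq by blast

lemma closed_C: "closed C"
proof -
  have "closed {x. k x = x}" if "k \<in> K" for k
    using continuous_strict_mono_surj[OF mono[OF that] surj[OF that]]
    by (intro closed_Collect_eq) auto
  then show ?thesis using gens unfolding C_def by (simp add: closed_Collect_conj)
qed

lemma E_subset_C: "E \<subseteq> C"
  unfolding E_def using closed_C by (rule frontier_subset_closed)

lemma fixed_E: "k \<in> K \<Longrightarrow> e \<in> E \<Longrightarrow> k e = e"
  using fixed E_subset_C by blast

text \<open>A gap is connected and misses the frontier of \<open>C\<close>, so it cannot meet both
  \<open>C\<close> and its complement.\<close>

lemma gap_disjoint_C:
  assumes "x \<in> gap E Z" "x \<notin> C"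
  shows "gap E Z \<inter> C = {}"
  using connected_Int_frontier[OF convex_connected[OF convex_gap[of E Z]], of C] assms gap_disjoint[of E Z]
  unfolding E_def by blast

lemma cut_image: "k \<in> K \<Longrightarrow> cut E (k x) = cut E x"
  unfolding cut_def using less_iff[of k] fixed_E[of k] by (metis (no_types, lifting))

lemma gap_image:
  assumes "k \<in> K"
  shows "k x \<in> gap E Z \<longleftrightarrow> x \<in> gap E Z"
proof -
  have "k x \<in> E \<longleftrightarrow> x \<in> E"
    using fixed_E[OF assms, of x] fixed_E[OF assms, of "k x"] inj_iff[OF assms, of "k x" x] by auto
  then show ?thesis unfolding gap_def by (simp add: cut_image[OF assms])
qed

lemma gap_iff:
  assumes "x \<in> gap E Z"
  shows "y \<in> gap E Z \<longleftrightarrow> y \<notin> E \<and> (\<forall>e\<in>E. e < y \<longleftrightarrow> e < x)"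
  using assms unfolding gap_def cut_def by blast

text \<open>The supremum of the orbit of \<open>l\<close> would otherwise be a common fixed point in the gap.\<close>

lemma displace:
  assumes "l \<in> gap E Z" "r \<in> gap E Z" "gap E Z \<inter> C = {}"
  shows "\<exists>h\<in>K. r < h l"
proof (rule ccontr)
  assume "\<not> ?thesis"
  then have le: "h l \<le> r" if "h \<in> K" for h using that by force
  define s where "s = (SUP h\<in>K. h l)"
  have bdd: "bdd_above ((\<lambda>h. h l) ` K)" using le by (intro bdd_aboveI2)
  have upper: "h l \<le> s" if "h \<in> K" for h
    unfolding s_def using bdd that by (intro cSUP_upper)
  \<comment> \<open>If h s < s, some orbit point k l exceeds h s; applying the inverse of h gives an
    orbit point above the supremum.\<close>
  have not_less: "\<not> h s < s" if "h \<in> K" for h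
  proof
    assume "h s < s"
    then obtain k where k: "k \<in> K" "h s < k l"
      unfolding s_def using less_cSUP_iff[OF _ bdd] gens(1) by blast
    have "h s < h ((inverse_of h \<circ> k) l)" using k that by simp
    then have "s < (inverse_of h \<circ> k) l" using less_iff[OF that] by blast
    moreover have "inverse_of h \<circ> k \<in> K" using comp inverse k that by blast
    ultimately show False using upper by fastforce
  qed
  have fix_s: "h s = s" if "h \<in> K" for h
  proof (rule antisym)
    have "\<not> inverse_of h s < s" using not_less inverse that by blast
    then have "\<not> h (inverse_of h s) < h s" using less_iff[OF that] by blast
    then show "h s \<le> s" using that by simp
  qed (use not_less[OF that] in simp)
  \<comment> \<open>The identity is obtained as an element of \<open>K\<close> in the form
    \<open>inverse_of f \<circ> f\<close>.\<close>
  have "l \<le> s" using upper[of "inverse_of f \<circ> f"] comp inverse gens by simp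
  moreover have "s \<le> r" unfolding s_def using gens(1) le by (intro cSUP_least) auto
  ultimately have "s \<in> gap E Z" using assms convex_gap[of E Z] convex_real_iff by blast
  moreover have "s \<in> C" unfolding C_def using fix_s gens by simp
  ultimately show False using assms(3) by blast
qed

text \<open>Each end of the gap is infinite or a point of \<open>E\<close>, and \<open>F\<close> is
  trivial on the inner side of it. So the part of the support inside the gap lies in a compact
  interval of the gap.\<close>

lemma bounded_support:
  assumes triv: "trivial_at_ends E F" and x: "x \<in> gap E Z"
  obtains l r where "l \<in> gap E Z" "r \<in> gap E Z" "\<And>y. y \<in> gap E Z \<Longrightarrow> F y \<noteq> y \<Longrightarrow> l \<le> y \<and> y \<le> r"
proof -
  have trivD: "\<forall>\<^sub>F y in \<F>. F y = y" if "(\<F>, \<tau>) \<in> ends E" for \<F> \<tau>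
    using triv that unfolding trivial_at_ends_def by blast
  note gap = gap_iff[OF x]
  have "x \<notin> E" using x unfolding gap_def by simp
  obtain r where r: "r \<in> gap E Z" "\<And>y. y \<in> gap E Z \<Longrightarrow> F y \<noteq> y \<Longrightarrow> y \<le> r"
  proof (cases "{e\<in>E. x < e} = {}")
    case True
    obtain N where N: "\<And>y. y \<ge> N \<Longrightarrow> F y = y"
      using trivD[of at_top id] unfolding ends_def eventually_at_top_linorder by auto
    have lt: "e < x" if "e \<in> E" for e
      using True that \<open>x \<notin> E\<close> by (metis (mono_tags, lifting) empty_Collect_eq linorder_neqE)
    show ?thesis
    proof (rule that)
      show "max N x \<in> gap E Z" unfolding gap using lt by force
      show "y \<le> max N x" if "F y \<noteq> y" for y using N[of y] that by (cases "N \<le> y") auto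
    qed
  next
    case False
    define e where "e = Min {e\<in>E. x < e}"
    have e: "e \<in> E" "x < e" "\<And>d. d \<in> E \<Longrightarrow> x < d \<Longrightarrow> e \<le> d"
      using Min_in[OF _ False] Min_le[of "{e\<in>E. x < e}"] finite_E unfolding e_def by auto
    obtain b where b: "b < e" "\<And>y. b < y \<Longrightarrow> y < e \<Longrightarrow> F y = y"
      using trivD[of "at_left e" "\<lambda>x. 1 / (x - e)"] e(1)
      unfolding ends_def eventually_at_left[OF e(2)] by auto
    \<comment> \<open>The midpoint lies above both \<open>b\<close> and \<open>x\<close> and still
      below \<open>e\<close>, so it stays in the gap and bounds the support.\<close>
    define r where "r = (max b x + e) / 2"
    have r: "b < r" "x < r" "r < e" using b(1) e(2) unfolding r_def by (auto simp: max_def field_simps)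
    show ?thesis
    proof (rule that)
      show "r \<in> gap E Z" unfolding gap using r e(3) \<open>x \<notin> E\<close> by (smt (verit))
      show "y \<le> r" if "y \<in> gap E Z" "F y \<noteq> y" for y
        using that b(2)[of y] r e(1,2) unfolding gap by (smt (verit))
    qed
  qed
  obtain l where l: "l \<in> gap E Z" "\<And>y. y \<in> gap E Z \<Longrightarrow> F y \<noteq> y \<Longrightarrow> l \<le> y"
  proof (cases "{e\<in>E. e < x} = {}")
    case True
    obtain N where N: "\<And>y. y \<le> N \<Longrightarrow> F y = y"
      using trivD[of at_bot id] unfolding ends_def eventually_at_bot_linorder by auto
    have lt: "x < e" if "e \<in> E" for e
      using True that \<open>x \<notin> E\<close> by (metis (mono_tags, lifting) empty_Collect_eq linorder_neqE)
    show ?thesis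
    proof (rule that)
      show "min N x \<in> gap E Z" unfolding gap using lt by force
      show "min N x \<le> y" if "F y \<noteq> y" for y using N[of y] that by (cases "y \<le> N") auto
    qed
  next
    case False
    define e where "e = Max {e\<in>E. e < x}"
    have e: "e \<in> E" "e < x" "\<And>d. d \<in> E \<Longrightarrow> d < x \<Longrightarrow> d \<le> e"
      using Max_in[OF _ False] Max_ge[of "{e\<in>E. e < x}"] finite_E unfolding e_def by auto
    obtain b where b: "e < b" "\<And>y. e < y \<Longrightarrow> y < b \<Longrightarrow> F y = y"
      using trivD[of "at_right e" "\<lambda>x. 1 / (x - e)"] e(1)
      unfolding ends_def eventually_at_right[OF e(2)] by auto
    define l where "l = (min b x + e) / 2"
    have l: "l < b" "l < x" "e < l" using b(1) e(2) unfolding l_def by (auto simp: min_def field_simps)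
    show ?thesis
    proof (rule that)
      show "l \<in> gap E Z" unfolding gap using l e \<open>x \<notin> E\<close> by (smt (verit))
      show "l \<le> y" if "y \<in> gap E Z" "F y \<noteq> y" for y
        using that b(2)[of y] l e(1,2) unfolding gap by (smt (verit))
    qed
  qed
  show ?thesis using that l r by blast
qed

lemma trivial_at_ends_conj:
  assumes "trivial_at_ends E F" "h \<in> K"
  shows "trivial_at_ends E (h \<circ> F \<circ> inverse_of h)"
  using assms filterlim_ends[OF mono surj, of "inverse_of h" E] inverse fixed_E
  by (intro trivial_at_ends_conjugate) auto

text \<open>The moved points serve to prove independence: at x only u acts, which forces the
  exponent of u to vanish in a relation, and then y does the same for v.\<close>

lemma commuting_pair:
  assumes "k \<in> K" "trivial_at_ends E k" "k \<noteq> id"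
  shows "\<exists>u\<in>K. \<exists>v\<in>K. u \<circ> v = v \<circ> u \<and> (\<exists>x. u x \<noteq> x \<and> v x = x) \<and> (\<exists>y. v y \<noteq> y)"
proof -
  define N where "N = (\<lambda>u. u \<in> K \<and> trivial_at_ends E u \<and> u \<noteq> id)"
  \<comment> \<open>Number of components met by the support; the codes of the components are
    counted.\<close>
  define m where "m = (\<lambda>u. card (cut E ` {x. u x \<noteq> x}))"
  have "N k" unfolding N_def using assms by simp
  then obtain u where u: "N u" "\<And>w. N w \<Longrightarrow> m u \<le> m w"
    using ex_has_least_nat[of N k m] by blast
  have uK: "u \<in> K" and u_triv: "trivial_at_ends E u" using u(1) unfolding N_def by auto
  obtain x where x: "u x \<noteq> x" using u(1) unfolding N_def by fastforce
  then have "x \<notin> C" using fixed uK by blast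
  define Z where "Z = cut E x"
  have xZ: "x \<in> gap E Z" using \<open>x \<notin> C\<close> E_subset_C unfolding gap_def Z_def by blast
  have ZC: "gap E Z \<inter> C = {}" using gap_disjoint_C[OF xZ \<open>x \<notin> C\<close>] .
  obtain l r where lr: "l \<in> gap E Z" "r \<in> gap E Z"
    "\<And>y. y \<in> gap E Z \<Longrightarrow> u y \<noteq> y \<Longrightarrow> l \<le> y \<and> y \<le> r"
    using bounded_support[OF u_triv xZ] by blast
  obtain h where h: "h \<in> K" "r < h l" using displace[OF lr(1,2) ZC] by blast
  define v where "v = h \<circ> u \<circ> inverse_of h"
  have vK: "v \<in> K" unfolding v_def using comp inverse h(1) uK by blast
  have v_triv: "trivial_at_ends E v" unfolding v_def using trivial_at_ends_conj[OF u_triv h(1)] .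
  have v_h: "v (h y) = h (u y)" for y unfolding v_def using h(1) by simp
  \<comment> \<open>Conjugation by h carries the support of u to that of v, and h preserves the gap;
    so this part of the support of v starts at \<open>h l\<close>, beyond \<open>r\<close>.\<close>
  have v_supp: "h l \<le> y" if y: "y \<in> gap E Z" "v y \<noteq> y" for y
  proof -
    obtain z where z: "y = h z" using h(1) inverse_of(2) by metis
    then have "z \<in> gap E Z" "u z \<noteq> z" using y gap_image[OF h(1)] v_h by auto
    then have "\<not> z < l" using lr(3) by force
    then show ?thesis unfolding z using less_iff[OF h(1), of z l] by simp
  qed
  have disjoint: "u y = y \<or> v y = y" if "y \<in> gap E Z" for y
    using lr(3)[OF that] v_supp[OF that] h(2) by linarith
  \<comment> \<open>An injective map sends moved points to moved points. So u and v each preserve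
    their own support in the gap, where the other acts trivially.\<close>
  have comm_gap: "u (v y) = v (u y)" if y: "y \<in> gap E Z" for y
  proof (cases "u y = y")
    case True
    have "u (v y) = v y"
    proof (cases "v y = y")
      case False
      then have "v (v y) \<noteq> v y" using inj_iff[OF vK] by simp
      then show ?thesis using disjoint[of "v y"] gap_image[OF vK] y by blast
    qed (simp add: True)
    then show ?thesis using True by simp
  next
    case False
    then have "u (u y) \<noteq> u y" using inj_iff[OF uK] by simp
    then have "v (u y) = u y" using disjoint[of "u y"] gap_image[OF uK] y by blast
    then show ?thesis using False disjoint[OF y] by simp
  qed
  define w where "w = u \<circ> v \<circ> inverse_of u \<circ> inverse_of v"
  have wK: "w \<in> K" unfolding w_def using comp inverse uK vK by blast
  \<comment> \<open>For y = v (u z), the commutator fixes y exactly when u and v commute at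
    z.\<close>
  have w_eq: "w y = y \<longleftrightarrow> u (v z) = v (u z)" if "z = inverse_of u (inverse_of v y)" for y z
    using that uK vK unfolding w_def by simp
  have "trivial_at_ends E w"
    unfolding w_def using u_triv v_triv uK vK
    by (intro trivial_at_ends_comp) (auto intro: trivial_at_ends_inverse)
  have "w = id"
  proof (rule ccontr)
    assume "w \<noteq> id"
    then have "m u \<le> m w" using u(2) wK \<open>trivial_at_ends E w\<close> unfolding N_def by blast
    \<comment> \<open>The commutator is trivial in the component \<open>Z\<close>. Elsewhere, if u
      and v fail to commute at z, then u moves z or v z, and these lie in the same component. So the
      commutator meets fewer components than u.\<close>
    have "cut E ` {y. w y \<noteq> y} \<subseteq> cut E ` {x. u x \<noteq> x} - {Z}"
    proof
      fix A assume "A \<in> cut E ` {y. w y \<noteq> y}"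
      then obtain y where y: "w y \<noteq> y" "A = cut E y" by blast
      define z where "z = inverse_of u (inverse_of v y)"
      have z: "u (v z) \<noteq> v (u z)" using w_eq[OF z_def] y(1) by simp
      have cut_z: "A = cut E z" unfolding y(2) z_def using cut_image inverse uK vK by simp
      have "z \<notin> C" using z fixed uK vK by metis
      then have "z \<in> gap E A" using E_subset_C cut_z unfolding gap_def by blast
      then have "A \<noteq> Z" using z comm_gap by blast
      moreover have "A \<in> cut E ` {x. u x \<noteq> x}"
      proof (cases "u z = z")
        case True
        then have "u (v z) \<noteq> v z" using z by simp
        then show ?thesis using cut_z cut_image[OF vK, of z] by blast
      qed (use cut_z in blast)
      ultimately show "A \<in> cut E ` {x. u x \<noteq> x} - {Z}" by blast
    qed
    moreover have "finite (cut E ` {x. u x \<noteq> x})"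
      using finite_E cut_in_Pow[of E] by (meson finite_Pow_iff finite_subset image_subsetI)
    moreover have "Z \<in> cut E ` {x. u x \<noteq> x}" using x unfolding Z_def by blast
    ultimately have "m w < m u"
      unfolding m_def by (meson card_Diff1_less card_mono finite_Diff le_less_trans)
    then show False using \<open>m u \<le> m w\<close> by simp
  qed
  have "u \<circ> v = v \<circ> u"
  proof
    fix z
    have "w (v (u z)) = v (u z)" using \<open>w = id\<close> by simp
    then show "(u \<circ> v) z = (v \<circ> u) z" using w_eq[of z "v (u z)"] uK vK by simp
  qed
  moreover have "v x = x" using disjoint[OF xZ] x by blast
  moreover have "v (h x) \<noteq> h x" using v_h inj_iff[OF h(1)] x by simp
  ultimately show ?thesis using uK vK x by blast
qed

end

subsection \<open>Passing to the groups\<close>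

text \<open>As u and v commute, the pairs of exponents map homomorphically to the group;
  \<open>free\<close> says that the kernel is trivial, and the required subgroup is the
  image.\<close>

lemma (in group) free_abelian_rank_two:
  assumes K: "subgroup K G" and uv: "u \<in> K" "v \<in> K" "u \<otimes> v = v \<otimes> u"
    and free: "\<And>(m :: int) (n :: int). u [^] m \<otimes> v [^] n = \<one> \<Longrightarrow> m = 0 \<and> n = 0"
  shows "\<exists>A\<subseteq>K. subgroup A G \<and> G\<lparr>carrier := A\<rparr> \<cong> integer_group \<times>\<times> integer_group"
proof -
  let ?Z2 = "integer_group \<times>\<times> integer_group"
  define \<Phi> where "\<Phi> = (\<lambda>(m :: int, n :: int). u [^] m \<otimes> v [^] n)"
  have car: "u \<in> carrier G" "v \<in> carrier G" using uv subgroup.mem_carrier[OF K] by auto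
  have commute: "x [^] m \<otimes> y = y \<otimes> x [^] m"
    if "x \<otimes> y = y \<otimes> x" "x \<in> carrier G" "y \<in> carrier G" for x y and m :: int
  proof (cases m rule: int_cases2)
    case (nonneg n)
    then show ?thesis using group_commutes_pow[OF that] by (simp add: int_pow_int)
  next
    case (nonpos n)
    have "x [^] n \<otimes> y = y \<otimes> x [^] n" by (rule group_commutes_pow[OF that])
    then have "y \<otimes> inv (x [^] n) = inv (x [^] n) \<otimes> y"
      using that by (metis inv_closed inv_solve_left inv_solve_right m_assoc m_closed nat_pow_closed)
    then show ?thesis using that nonpos by (simp add: int_pow_neg_int)
  qed
  have comm: "u [^] m \<otimes> v [^] n = v [^] n \<otimes> u [^] m" for m n :: int
    using commute[of v "u [^] m" n] commute[OF uv(3) car, of m] car by simp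
  interpret Z2: group ?Z2 by (intro DirProd_group) simp_all
  have hom: "\<Phi> \<in> hom ?Z2 G"
  proof (rule homI)
    fix p q
    have "u [^] (m + m') \<otimes> v [^] (n + n') = (u [^] m \<otimes> v [^] n) \<otimes> (u [^] m' \<otimes> v [^] n')"
      for m m' n n' :: int
    proof -
      have "(u [^] m \<otimes> v [^] n) \<otimes> (u [^] m' \<otimes> v [^] n') = u [^] m \<otimes> ((v [^] n \<otimes> u [^] m') \<otimes> v [^] n')"
        using car by (simp add: m_assoc)
      also have "\<dots> = (u [^] m \<otimes> u [^] m') \<otimes> (v [^] n \<otimes> v [^] n')"
        unfolding comm[of m' n, symmetric] using car by (simp add: m_assoc)
      finally show ?thesis using car by (simp add: int_pow_mult)
    qed
    then show "\<Phi> (p \<otimes>\<^bsub>?Z2\<^esub> q) = \<Phi> p \<otimes> \<Phi> q"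
      by (cases p; cases q) (simp add: \<Phi>_def integer_group_def)
  qed (use car in \<open>auto simp: \<Phi>_def\<close>)
  then interpret \<Phi>: group_hom ?Z2 G \<Phi> by unfold_locales
  define A where "A = \<Phi> ` carrier ?Z2"
  have A: "subgroup A G" unfolding A_def by (rule \<Phi>.img_is_subgroup)
  have "inj_on \<Phi> (carrier ?Z2)"
    unfolding \<Phi>.inj_on_one_iff
  proof (intro allI impI)
    fix p assume "p \<in> carrier ?Z2" and "\<Phi> p = \<one>"
    then have "fst p = 0 \<and> snd p = 0" by (intro free) (simp add: \<Phi>_def case_prod_beta)
    then show "p = \<one>\<^bsub>?Z2\<^esub>" by (simp add: integer_group_def prod_eq_iff)
  qed
  then have "\<Phi> \<in> iso ?Z2 (G\<lparr>carrier := A\<rparr>)"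
    using hom unfolding iso_def hom_def bij_betw_def A_def by auto
  then have "G\<lparr>carrier := A\<rparr> \<cong> ?Z2" using Z2.iso_sym is_isoI by blast
  moreover have "A \<subseteq> K"
  proof -
    have "w [^] n \<in> K" if "w \<in> K" for w and n :: int
      using group.int_pow_closed[OF subgroup.subgroup_is_group[OF K group_axioms], of w n] that
      unfolding int_pow_consistent[OF K that, symmetric] by simp
    then show ?thesis unfolding A_def \<Phi>_def using uv subgroup.m_closed[OF K] by auto
  qed
  ultimately show ?thesis using A by blast
qed

text \<open>Working in \<open>Hgrp\<close> avoids a proof that \<open>Gset\<close> is closed under composition, where
  intersections of arcs may be disconnected.\<close>

definition Hgrp :: "(P1 \<Rightarrow> P1) monoid" where
  "Hgrp = Ggrp\<lparr>carrier := Hset\<rparr>"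

lemma Hgrp_simps [simp]:
  "carrier Hgrp = Hset" "x \<otimes>\<^bsub>Hgrp\<^esub> y = x \<circ> y" "\<one>\<^bsub>Hgrp\<^esub> = id"
  unfolding Hgrp_def Ggrp_def by simp_all

lemma Ggrp_simps [simp]:
  "carrier Ggrp = Gset" "x \<otimes>\<^bsub>Ggrp\<^esub> y = x \<circ> y" "\<one>\<^bsub>Ggrp\<^esub> = id"
  unfolding Ggrp_def by simp_all

lemma Hset_inverse_comp:
  assumes "f \<in> Hset"
  shows "f \<circ> inv_into UNIV f = id" "inv_into UNIV f \<circ> f = id"
  using Hset_bij[OF assms] by (auto simp: bij_def surj_iff inj_iff)

lemma group_Hgrp: "group Hgrp"
proof (rule groupI)
  fix f assume "f \<in> carrier Hgrp"
  then show "\<exists>g\<in>carrier Hgrp. g \<otimes>\<^bsub>Hgrp\<^esub> f = \<one>\<^bsub>Hgrp\<^esub>"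
    using Hset_inverse(1) Hset_inverse_comp(2) by (intro bexI[of _ "inv_into UNIV f"]) auto
qed (auto simp: Hset_comp id_Hset comp_assoc)

interpretation H: group Hgrp by (rule group_Hgrp)

text \<open>The group inverse is a definite description over the carrier and makes sense without the
  group laws. Thus one statement serves both \<open>Hgrp\<close> and \<open>Ggrp\<close>.\<close>

lemma inv_eq_inv_into:
  assumes "f \<in> Hset" and G: "carrier G \<supseteq> Hset" "\<And>x y. x \<otimes>\<^bsub>G\<^esub> y = x \<circ> y" "\<one>\<^bsub>G\<^esub> = id"
  shows "inv\<^bsub>G\<^esub> f = inv_into UNIV f"
  unfolding m_inv_def
proof (rule the_equality)
  show "inv_into UNIV f \<in> carrier G \<and> f \<otimes>\<^bsub>G\<^esub> inv_into UNIV f = \<one>\<^bsub>G\<^esub> \<and> inv_into UNIV f \<otimes>\<^bsub>G\<^esub> f = \<one>\<^bsub>G\<^esub>"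
    using Hset_inverse(1) Hset_inverse_comp assms by auto
  fix g assume "g \<in> carrier G \<and> f \<otimes>\<^bsub>G\<^esub> g = \<one>\<^bsub>G\<^esub> \<and> g \<otimes>\<^bsub>G\<^esub> f = \<one>\<^bsub>G\<^esub>"
  then have "f \<circ> g = id" "g \<circ> f = id" using G by auto
  then show "g = inv_into UNIV f" using inv_unique_comp by metis
qed

lemma inv_Hgrp [simp]: "f \<in> Hset \<Longrightarrow> inv\<^bsub>Hgrp\<^esub> f = inv_into UNIV f"
  by (rule inv_eq_inv_into) simp_all

lemma Hset_subset_Gset: "Hset \<subseteq> Gset"
  unfolding Hset_def by blast

lemma inv_Ggrp [simp]: "f \<in> Hset \<Longrightarrow> inv\<^bsub>Ggrp\<^esub> f = inv_into UNIV f"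
  by (rule inv_eq_inv_into) (simp_all add: Hset_subset_Gset)

text \<open>On elements of \<open>Hset\<close> both structures have the same product, unit and
  inverse, so the two inductive closures agree. This transfers the results for \<open>Hgrp\<close>
  to \<open>Ggrp\<close>.\<close>

lemma generate_Ggrp:
  assumes "S \<subseteq> Hset"
  shows "generate Ggrp S = generate Hgrp S"
proof
  show "generate Ggrp S \<subseteq> generate Hgrp S"
  proof
    fix x assume "x \<in> generate Ggrp S"
    then show "x \<in> generate Hgrp S"
    proof induction
      case one
      then show ?case using generate.one[of Hgrp S] unfolding Hgrp_simps Ggrp_simps .
    next
      case (incl h)
      then show ?case by (rule generate.incl)
    next
      case (inv h)
      then have "inv\<^bsub>Ggrp\<^esub> h = inv\<^bsub>Hgrp\<^esub> h" using assms by auto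
      then show ?case using generate.inv[OF inv, of Hgrp] by (simp only:)
    next
      case (eng h1 h2)
      then show ?case using generate.eng[of h1 Hgrp S h2] unfolding Hgrp_simps Ggrp_simps by blast
    qed
  qed
  show "generate Hgrp S \<subseteq> generate Ggrp S"
  proof
    fix x assume "x \<in> generate Hgrp S"
    then show "x \<in> generate Ggrp S"
    proof induction
      case one
      then show ?case using generate.one[of Ggrp S] unfolding Hgrp_simps Ggrp_simps .
    next
      case (incl h)
      then show ?case by (rule generate.incl)
    next
      case (inv h)
      then have "inv\<^bsub>Hgrp\<^esub> h = inv\<^bsub>Ggrp\<^esub> h" using assms by auto
      then show ?case using generate.inv[OF inv, of Ggrp] by (simp only:)
    next
      case (eng h1 h2)
      then show ?case using generate.eng[of h1 Ggrp S h2] unfolding Hgrp_simps Ggrp_simps by blast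
    qed
  qed
qed

lemma derived_Ggrp:
  assumes "K \<subseteq> Hset"
  shows "derived Ggrp K = derived Hgrp K"
proof -
  have inv: "inv\<^bsub>Ggrp\<^esub> h = inv\<^bsub>Hgrp\<^esub> h" if "h \<in> K" for h using that assms by auto
  then have eq: "derived_set Ggrp K = derived_set Hgrp K" by simp
  have "derived_set Hgrp K \<subseteq> Hset" using H.derived_set_in_carrier[of K] assms by simp
  then show ?thesis unfolding derived_def eq by (rule generate_Ggrp)
qed

lemma subgroup_Ggrp:
  assumes "subgroup A Hgrp"
  shows "subgroup A Ggrp"
proof
  have A: "A \<subseteq> Hset" using subgroup.subset[OF assms] by simp
  then show "A \<subseteq> carrier Ggrp" using Hset_subset_Gset by simp
  show "x \<otimes>\<^bsub>Ggrp\<^esub> y \<in> A" if "x \<in> A" "y \<in> A" for x y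
    using subgroup.m_closed[OF assms that] by simp
  show "\<one>\<^bsub>Ggrp\<^esub> \<in> A" using subgroup.one_closed[OF assms] by simp
  show "inv\<^bsub>Ggrp\<^esub> x \<in> A" if "x \<in> A" for x
    using subgroup.m_inv_closed[OF assms that] that A by (auto simp: subset_iff)
qed

lemma carrier_update_Ggrp: "Ggrp\<lparr>carrier := A\<rparr> = Hgrp\<lparr>carrier := A\<rparr>"
  unfolding Hgrp_def by simp

section \<open>Powers of an element acting on the line\<close>

lemma on_line_comp_H: "g \<in> Hset \<Longrightarrow> on_line (f \<circ> g) = on_line f \<circ> on_line g"
  by (simp add: on_line_comp bij_is_inj Hset_bij)

lemma on_line_mult:
  "k \<in> Hset \<Longrightarrow> on_line (h \<otimes>\<^bsub>Hgrp\<^esub> k) x = on_line h (on_line k x)"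
  by (simp add: on_line_comp_H)

lemma on_line_pow_Suc:
  "k \<in> Hset \<Longrightarrow> on_line (k [^]\<^bsub>Hgrp\<^esub> Suc m) x = on_line (k [^]\<^bsub>Hgrp\<^esub> m) (on_line k x)"
  by (simp add: on_line_comp_H)

lemma on_line_pow_0: "on_line (k [^]\<^bsub>Hgrp\<^esub> (0 :: nat)) x = x"
  by simp

lemma on_line_int_pow_fixed:
  assumes k: "k \<in> Hset" "on_line k x = x"
  shows "on_line (k [^]\<^bsub>Hgrp\<^esub> (n :: int)) x = x"
proof -
  have nat: "on_line (k [^]\<^bsub>Hgrp\<^esub> (m :: nat)) x = x" for m
  proof (induction m)
    case (Suc m)
    then show ?case unfolding on_line_pow_Suc[OF k(1)] k(2) .
  qed (rule on_line_pow_0)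
  show ?thesis
  proof (cases n rule: int_cases2)
    case (nonneg m)
    then show ?thesis using nat by (simp add: int_pow_int)
  next
    case (nonpos m)
    let ?h = "k [^]\<^bsub>Hgrp\<^esub> m"
    have h: "?h \<in> Hset" using k(1) H.nat_pow_closed[of k m] by simp
    have F: "strict_mono (on_line ?h)" "surj (on_line ?h)" using on_line_PM[OF h] unfolding PM_def by auto
    have "on_line (inv_into UNIV ?h) x = x"
      unfolding Hset_inverse(2)[OF h] using inv_into_strict_mono_surj(1)[OF F, of x] nat by simp
    then show ?thesis using h k(1) nonpos by (simp add: H.int_pow_neg_int)
  qed
qed

text \<open>An increasing map pushes the orbit of a moved point ever further in one direction, so no
  nonzero power returns it.\<close>

lemma on_line_int_pow_moved:
  assumes k: "k \<in> Hset" "on_line k x \<noteq> x" and "n \<noteq> 0"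
  shows "on_line (k [^]\<^bsub>Hgrp\<^esub> (n :: int)) x \<noteq> x"
proof -
  let ?F = "on_line k"
  have F: "strict_mono ?F" using on_line_PM[OF k(1)] unfolding PM_def by auto
  note Suc_simp = on_line_pow_Suc[OF k(1)]
  have pow_mono: "strict_mono (on_line (k [^]\<^bsub>Hgrp\<^esub> (m :: nat)))" for m
    using on_line_PM[of "k [^]\<^bsub>Hgrp\<^esub> m"] H.nat_pow_closed[of k m] k(1) unfolding PM_def by simp
  have nat: "on_line (k [^]\<^bsub>Hgrp\<^esub> (m :: nat)) x \<noteq> x" if "m > 0" for m
  proof (cases "?F x > x")
    case True
    have "on_line (k [^]\<^bsub>Hgrp\<^esub> Suc m) x > x" for m
    proof (induction m)
      case 0
      then show ?case using True unfolding Suc_simp on_line_pow_0 .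
    next
      case (Suc m)
      then show ?case using strict_monoD[OF pow_mono True, of "Suc m"] unfolding Suc_simp[of "Suc m"] by linarith
    qed
    then show ?thesis using that by (metis gr0_implies_Suc less_irrefl)
  next
    case False
    then have lt: "?F x < x" using k(2) by simp
    have "on_line (k [^]\<^bsub>Hgrp\<^esub> Suc m) x < x" for m
    proof (induction m)
      case 0
      then show ?case using lt unfolding Suc_simp on_line_pow_0 .
    next
      case (Suc m)
      then show ?case using strict_monoD[OF pow_mono lt, of "Suc m"] unfolding Suc_simp[of "Suc m"] by linarith
    qed
    then show ?thesis using that by (metis gr0_implies_Suc less_irrefl)
  qed
  show ?thesis
  proof (cases n rule: int_cases2)
    case (nonneg m)
    then show ?thesis using nat[of m] \<open>n \<noteq> 0\<close> by (simp add: int_pow_int)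
  next
    case (nonpos m)
    let ?h = "k [^]\<^bsub>Hgrp\<^esub> m"
    have h: "?h \<in> Hset" using k(1) H.nat_pow_closed[of k m] by simp
    have F: "strict_mono (on_line ?h)" "surj (on_line ?h)" using on_line_PM[OF h] unfolding PM_def by auto
    have "on_line (inv_into UNIV ?h) x \<noteq> x"
      unfolding Hset_inverse(2)[OF h] using inv_into_strict_mono_surj(2)[OF F, of x] nat[of m] nonpos \<open>n \<noteq> 0\<close> by force
    then show ?thesis using h k(1) nonpos by (simp add: H.int_pow_neg_int)
  qed
qed

section \<open>The alternative for two elements of H\<close>

theorem theorem3:
  assumes "f \<in> Hset" and "g \<in> Hset"
  shows "metabelian_in Ggrp (generate Ggrp {f, g}) \<or> contains_Z2_in Ggrp (generate Ggrp {f, g})"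
proof -
  define K where "K = generate Hgrp {f, g}"
  have K_eq: "generate Ggrp {f, g} = K" unfolding K_def using assms by (intro generate_Ggrp) simp
  have K: "subgroup K Hgrp" unfolding K_def using assms by (intro H.generate_is_subgroup) simp
  have KH: "k \<in> Hset" if "k \<in> K" for k using subgroup.mem_carrier[OF K that] by simp
  have fg: "f \<in> K" "g \<in> K" unfolding K_def by (auto intro: generate.incl)
  define C where "C = {x. on_line f x = x \<and> on_line g x = x}"
  define E where "E = frontier C"
  have K_fixed: "on_line k x = x" if "k \<in> K" "x \<in> C" for k x
    using that(1) unfolding K_def
  proof induction
    case (incl h)
    then show ?case using that(2) unfolding C_def by auto
  next
    case (inv h)
    then have h: "h \<in> Hset" "on_line h x = x" using assms that(2) unfolding C_def by auto
    \<comment> \<open>The inverse is the power with exponent -1, whose fixed points are already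
      controlled.\<close>
    then have "inv\<^bsub>Hgrp\<^esub> h = h [^]\<^bsub>Hgrp\<^esub> (- 1 :: int)" by (simp only: H.int_pow_neg H.int_pow_1 Hgrp_simps)
    then show ?case using on_line_int_pow_fixed[OF h, of "-1"] by (simp only:)
  next
    case (eng h1 h2)
    then have "h2 \<in> Hset" using KH unfolding K_def by blast
    then show ?case using eng by (simp only: on_line_mult)
  next
    case one
    have "on_line \<one>\<^bsub>Hgrp\<^esub> x = x" by simp
    then show ?case .
  qed
  \<comment> \<open>The frontier of an intersection lies in the union of the two frontiers, both of
    which are finite.\<close>
  have "C = {x. on_line f x = x} \<inter> {x. on_line g x = x}" unfolding C_def by blast
  then have fin: "finite E"
    unfolding E_def using finite_frontier_fixed_points on_line_PM assms frontier_Int_subset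
    by (metis finite_Un finite_subset)
  interpret line_action "on_line ` K" "on_line f" "on_line g" C E
  proof
    fix h k assume "h \<in> on_line ` K" "k \<in> on_line ` K"
    then obtain h' k' where hk: "h' \<in> K" "k' \<in> K" "h = on_line h'" "k = on_line k'" by blast
    then have PM: "h \<in> PM" using KH on_line_PM by blast
    show "strict_mono h" "surj h" using PM unfolding PM_def by auto
    have "h \<circ> k = on_line (h' \<circ> k')" using hk KH by (simp add: on_line_comp_H)
    moreover have "h' \<circ> k' \<in> K" using subgroup.m_closed[OF K hk(1,2)] by simp
    ultimately show "h \<circ> k \<in> on_line ` K" by blast
    have "inv_into UNIV h = on_line (inv_into UNIV h')" using hk KH by (simp add: Hset_inverse(2))
    moreover have "inv_into UNIV h' \<in> K" using subgroup.m_inv_closed[OF K hk(1)] hk(1) KH by simp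
    ultimately show "inv_into UNIV h \<in> on_line ` K" by blast
    show "h x = x" if "x \<in> C" for x
      using K_fixed hk that by blast
  qed (use fg fin in \<open>auto simp: E_def C_def\<close>)
  define D where "D = derived Hgrp K"
  have DK: "D \<subseteq> K" unfolding D_def using H.derived_incl[OF subset_refl K] .
  have D: "subgroup D Hgrp" unfolding D_def using KH by (intro H.derived_is_subgroup) auto
  have lim: "filterlim (on_line k) \<F> \<F>" if "k \<in> K" "(\<F>, \<tau>) \<in> ends E" for k \<F> \<tau>
    using that by (intro filterlim_ends[OF mono surj fixed_E]) auto
  have inv_K: "inv_into UNIV k \<in> K" if "k \<in> K" for k
    using subgroup.m_inv_closed[OF K that] KH[OF that] by simp
  have germ: "\<exists>\<alpha> \<beta>. \<alpha> \<noteq> 0 \<and> affine_germ \<F> \<tau> \<alpha> \<beta> (on_line k)"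
    if "k \<in> K" "(\<F>, \<tau>) \<in> ends E" for k \<F> \<tau>
    using PM_affine_germ[OF on_line_PM[OF KH[OF that(1)]] _ that(2)] fixed_E that(1) by blast
  have commutator: "on_line (h \<circ> k \<circ> inv_into UNIV h \<circ> inv_into UNIV k) =
      on_line h \<circ> on_line k \<circ> on_line (inv_into UNIV h) \<circ> on_line (inv_into UNIV k)"
    if "h \<in> K" "k \<in> K" for h k
    using that KH inv_K by (simp add: on_line_comp_H)
  have inv_right: "on_line k (on_line (inv_into UNIV k) x) = x" if "k \<in> K" for k x
    using that KH inverse_of(2)[of "on_line k"] by (simp add: Hset_inverse(2))
  have commutator_germ: "\<exists>\<beta>. affine_germ \<F> \<tau> 1 \<beta> (on_line k)"
    if "k \<in> derived_set Hgrp K" and mem: "(\<F>, \<tau>) \<in> ends E" for k \<F> \<tau>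
  proof -
    from that obtain a b where "a \<in> K" "b \<in> K" "k = a \<otimes>\<^bsub>Hgrp\<^esub> b \<otimes>\<^bsub>Hgrp\<^esub> inv\<^bsub>Hgrp\<^esub> a \<otimes>\<^bsub>Hgrp\<^esub> inv\<^bsub>Hgrp\<^esub> b"
      by blast
    then have ab: "a \<in> K" "b \<in> K" "k = a \<circ> b \<circ> inv_into UNIV a \<circ> inv_into UNIV b"
      using KH by simp_all
    obtain \<alpha> \<beta> \<alpha>' \<beta>' where "\<alpha> \<noteq> 0" "affine_germ \<F> \<tau> \<alpha> \<beta> (on_line a)"
      "\<alpha>' \<noteq> 0" "affine_germ \<F> \<tau> \<alpha>' \<beta>' (on_line b)"
      using germ ab mem by meson
    then show ?thesis unfolding ab(3) commutator[OF ab(1,2)]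
      using affine_germ_commutator lim[OF _ mem] ab inv_K inv_right by blast
  qed
  \<comment> \<open>The generators of \<open>D\<close> are commutators and have translation germs;
    inverses and products of translations are again translations.\<close>
  have D_germ: "\<exists>\<beta>. affine_germ \<F> \<tau> 1 \<beta> (on_line k)" if "k \<in> D" and mem: "(\<F>, \<tau>) \<in> ends E" for k \<F> \<tau>
    using that(1) unfolding D_def derived_def
  proof induction
    case one
    have "\<exists>\<beta>. affine_germ \<F> \<tau> 1 \<beta> (on_line \<one>\<^bsub>Hgrp\<^esub>)"
      unfolding affine_germ_def by (intro exI[of _ 0]) simp
    then show ?case .
  next
    case (incl h)
    then show ?case using mem by (rule commutator_germ)
  next
    case (inv h)
    then have "h \<in> D" unfolding D_def derived_def by (rule generate.incl)
    then have hK: "h \<in> K" using DK by blast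
    obtain \<gamma> where "affine_germ \<F> \<tau> 1 \<gamma> (on_line h)" using commutator_germ[OF inv mem] ..
    from affine_germ_inverse[OF this _ lim[OF inv_K[OF hK] mem] inv_right[OF hK]]
    have "\<exists>\<beta>. affine_germ \<F> \<tau> 1 \<beta> (on_line (inv\<^bsub>Hgrp\<^esub> h))" using KH[OF hK] by auto
    then show ?case .
  next
    case (eng h k)
    then have hk: "h \<in> K" "k \<in> K" using DK unfolding D_def derived_def by auto
    obtain \<beta> \<beta>' where "affine_germ \<F> \<tau> 1 \<beta> (on_line h)" "affine_germ \<F> \<tau> 1 \<beta>' (on_line k)"
      using eng by blast
    from affine_germ_comp[OF this lim[OF hk(2) mem]]
    have "\<exists>\<beta>. affine_germ \<F> \<tau> 1 \<beta> (on_line (h \<otimes>\<^bsub>Hgrp\<^esub> k))"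
      using KH[OF hk(2)] by (auto simp: on_line_comp_H)
    then show ?case .
  qed
  show ?thesis
  proof (cases "\<forall>u\<in>D. \<forall>v\<in>D. u \<circ> v = v \<circ> u")
    case True
    have "group (Hgrp\<lparr>carrier := D\<rparr>)" using D group_Hgrp by (rule subgroup.subgroup_is_group)
    then have "comm_group (Hgrp\<lparr>carrier := D\<rparr>)"
      using True by (intro group.group_comm_groupI) auto
    moreover have "derived Ggrp K = D" unfolding D_def using KH by (intro derived_Ggrp) auto
    ultimately show ?thesis unfolding metabelian_in_def K_eq by (simp add: carrier_update_Ggrp)
  next
    case False
    then obtain u v where uv: "u \<in> D" "v \<in> D" "u \<circ> v \<noteq> v \<circ> u" by blast
    then have uvK: "u \<in> K" "v \<in> K" using DK by auto
    \<comment> \<open>Two elements of \<open>D\<close> that do not commute give a nontrivial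
      commutator, yet their translation germs commute at every end.\<close>
    define w where "w = u \<circ> v \<circ> inv_into UNIV u \<circ> inv_into UNIV v"
    have wK: "w \<in> K"
      unfolding w_def using subgroup.m_closed[OF K] uvK inv_K by simp
    have "w \<noteq> id"
    proof
      assume "w = id"
      then have "w \<circ> (v \<circ> u) = v \<circ> u" by simp
      moreover have "w \<circ> (v \<circ> u) = u \<circ> v"
        using Hset_inverse_comp(2)[OF KH[OF uvK(1)]] Hset_inverse_comp(2)[OF KH[OF uvK(2)]]
        unfolding w_def fun_eq_iff by simp
      ultimately show False using uv(3) by simp
    qed
    then have "on_line w \<noteq> id" using on_line_inject[OF KH[OF wK] id_Hset] by auto
    moreover have "trivial_at_ends E (on_line w)"
      unfolding trivial_at_ends_def
    proof clarify
      fix \<F> \<tau> assume mem: "(\<F>, \<tau>) \<in> ends E"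
      obtain \<beta> \<beta>' where "affine_germ \<F> \<tau> 1 \<beta> (on_line u)" "affine_germ \<F> \<tau> 1 \<beta>' (on_line v)"
        using D_germ[OF uv(1) mem] D_germ[OF uv(2) mem] by blast
      then have "affine_germ \<F> \<tau> 1 (1 * \<beta>' + \<beta> - 1 * \<beta> - \<beta>') (on_line w)"
        unfolding w_def commutator[OF uvK]
        by (intro affine_germ_commutator inv_right uvK lim[OF _ mem] inv_K) simp_all
      \<comment> \<open>The translation length is zero, so w preserves the coordinate near the end;
        injectivity of the coordinate gives w x = x.\<close>
      then show "\<forall>\<^sub>F x in \<F>. on_line w x = x"
        unfolding affine_germ_def by (simp add: ends_inject[OF mem])
    qed
    ultimately have "\<exists>P\<in>on_line ` K. \<exists>Q\<in>on_line ` K. P \<circ> Q = Q \<circ> P \<and>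
        (\<exists>x. P x \<noteq> x \<and> Q x = x) \<and> (\<exists>y. Q y \<noteq> y)"
      using wK by (intro commuting_pair) auto
    then obtain p q where pq: "p \<in> K" "q \<in> K" "on_line p \<circ> on_line q = on_line q \<circ> on_line p"
      and moved: "\<exists>x. on_line p x \<noteq> x \<and> on_line q x = x" "\<exists>y. on_line q y \<noteq> y"
      unfolding bex_simps by blast
    have pqH: "p \<in> Hset" "q \<in> Hset" using pq KH by auto
    have "p \<circ> q = q \<circ> p"
      using pq(3) pqH by (intro on_line_inject Hset_comp) (simp_all add: on_line_comp_H)
    moreover have "m = 0 \<and> n = 0"
      if "p [^]\<^bsub>Hgrp\<^esub> m \<otimes>\<^bsub>Hgrp\<^esub> q [^]\<^bsub>Hgrp\<^esub> n = \<one>\<^bsub>Hgrp\<^esub>" for m n :: int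
    proof -
      have pow: "p [^]\<^bsub>Hgrp\<^esub> m \<in> Hset" "q [^]\<^bsub>Hgrp\<^esub> n \<in> Hset"
        using H.int_pow_closed pqH by simp_all
      have eq: "on_line (p [^]\<^bsub>Hgrp\<^esub> m) (on_line (q [^]\<^bsub>Hgrp\<^esub> n) x) = x" for x
        using that on_line_comp_H[OF pow(2), of "p [^]\<^bsub>Hgrp\<^esub> m"] by (metis Hgrp_simps(2,3) comp_apply id_apply on_line_id)
      \<comment> \<open>Powers of q fix x, so the relation makes p^m fix x and m = 0; then q^n fixes
        the point y moved by q, and n = 0.\<close>
      obtain x where "on_line p x \<noteq> x" "on_line q x = x" using moved(1) by blast
      then have m: "m = 0"
        using eq[of x] on_line_int_pow_fixed[OF pqH(2)] on_line_int_pow_moved[OF pqH(1)] by metis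
      obtain y where "on_line q y \<noteq> y" using moved(2) by blast
      then have "n = 0" using eq[of y] m on_line_int_pow_moved[OF pqH(2)] by auto
      then show ?thesis using m by simp
    qed
    ultimately obtain A where "A \<subseteq> K" "subgroup A Hgrp"
      "Hgrp\<lparr>carrier := A\<rparr> \<cong> integer_group \<times>\<times> integer_group"
      using H.free_abelian_rank_two[OF K pq(1,2)] by auto
    then have "contains_Z2_in Ggrp K"
      unfolding contains_Z2_in_def carrier_update_Ggrp using subgroup_Ggrp by blast
    then show ?thesis unfolding K_eq ..
  qed
qed

end
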